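(* Let $K$ be a finite simplicial complex, $p\ge 0$ a homology degree, $\mathcal{M}$ a smooth finite-dimensional manifold without boundary, and $F:\mathcal{M}\to\mathbb{R}^K$ a map all of whose values are filter functions; let $B_p:=\mathrm{Dgm}_p\circ F:\mathcal{M}\to Bar$. Suppose $F$ is continuous over $\mathcal{M}$ and of class $C^r$ ($r\geq 0$) on some open subset $U$ of $\mathcal{M}$. Then $B_p$ is $r$-differentiable at every point of $U\cap\tilde{\mathcal{M}}$, where \[ \tilde{\mathcal{M}}:=\{\theta\in\mathcal{M}\mid \exists\text{ an open neighborhood }U_\theta\text{ of }\theta\text{ such that }F(\theta')\sim F(\theta)\text{ for all }\theta'\in U_\theta\}, \] and the set $\tilde{\mathcal{M}}$ is generic (i.e. open and dense) in $\mathcal{M}$. In particular, if $F$ is $C^r$ on some generic subset of $\mathcal{M}$, then $B_p$ is $r$-differentiable on some (possibly smaller) generic subset of $\mathcal{M}$.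
   Context: Barcodes: a barcode is a multiset $D=D'\cup\Delta^\infty$, where $D'$ is a finite multiset of elements of $\mathbb{R}\times(\mathbb{R}\cup\{+\infty\})$ and $\Delta^\infty$ consists of the diagonal $\Delta=\{(b,b)\mid b\in\mathbb{R}\}$ with countably infinite multiplicity. $Bar$ is the set of barcodes. For $m,n\in\mathbb{N}$, $Q_{m,n}:\mathbb{R}^{2m}\times\mathbb{R}^n\to Bar$ is $Q_{m,n}(b_1,d_1,\dots,b_m,d_m,v_1,\dots,v_n)=\{(b_i,d_i)\}_{i=1}^m\cup\{(v_j,+\infty)\}_{j=1}^n\cup\Delta^\infty$. A map $B:\mathcal{M}\to Bar$ is $r$-differentiable at $x$ ($r\in\mathbb{N}\cup\{+\infty\}$) if there are an open neighborhood $U$ of $x$, integers $m,n\in\mathbb{N}$ and a $C^r$ map $\tilde B:U\to\mathbb{R}^{2m}\times\mathbb{R}^n$ with $B=Q_{m,n}\circ\tilde B$ on $U$. Filter functions: $f:K\to\mathbb{R}$ is a filter function if $f(\sigma)\le f(\sigma')$ whenever $\sigma\subseteq\sigma'$ are simplices of $K$. $\mathbb{R}^K$ has its Euclidean structure. $\mathrm{Dgm}_p(f)\in Bar$ denotes the degree-$p$ barcode of $f$: with $K^t=\{\sigma\in K\mid f(\sigma)\le t\}$ and homology over a fixed field, the persistence module $(H_p(K^t))_{t\in\mathbb{R}}$ with maps induced by inclusions is isomorphic to a finite direct sum of interval modules $\bigoplus_{J\in\mathcal{J}}\mathbb{I}_J$, and $\mathrm{Dgm}_p(f)=\{(\inf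 J,\sup J)\}_{J\in\mathcal{J}}\cup\Delta^\infty$. Ordering equivalence: $f\sim g$ if $f$ and $g$ induce the same pre-order on simplices, i.e. for all $\sigma,\sigma'\in K$, $f(\sigma)\le f(\sigma')\iff g(\sigma)\le g(\sigma')$. *)

theory Defs
  imports
    "HOL-Analysis.Analysis"
    "HOL-Algebra.AbelCoset"
    "HOL-Algebra.Module"
    "HOL-Library.Multiset"
    "HOL-Library.Extended_Nat"
begin

section \<open>Maps of class \<open>C\<^sup>r\<close> and smooth manifolds\<close>

text \<open>
  Real functions on an open subset \<open>W\<close> of \<open>\<real>\<^sup>n\<close>, where \<open>\<real>\<^sup>n\<close> is \<^term>\<open>Euclidean_space n\<close>, the
  sequences vanishing from index \<open>n\<close> on (so that \<open>n\<close> is an ordinary natural number, possibly 0).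
  Class \<open>C\<^sup>k\<close> means that all iterated partial derivatives up to order \<open>k\<close> exist and are
  continuous on \<open>W\<close>.
\<close>

definition partial_deriv :: "nat \<Rightarrow> ((nat \<Rightarrow> real) \<Rightarrow> real) \<Rightarrow> (nat \<Rightarrow> real) \<Rightarrow> real" where
  "partial_deriv i f y = deriv (\<lambda>t. f (y(i := t))) (y i)"

fun Ck_euclid :: "nat \<Rightarrow> nat \<Rightarrow> (nat \<Rightarrow> real) set \<Rightarrow> ((nat \<Rightarrow> real) \<Rightarrow> real) \<Rightarrow> bool" where
  "Ck_euclid n 0 W f \<longleftrightarrow> continuous_map (subtopology (Euclidean_space n) W) euclideanreal f"
| "Ck_euclid n (Suc k) W f \<longleftrightarrow>
     continuous_map (subtopology (Euclidean_space n) W) euclideanreal f \<and>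
     (\<forall>i<n. (\<forall>y\<in>W. (\<lambda>t. f (y(i := t))) field_differentiable (at (y i))) \<and>
            Ck_euclid n k W (partial_deriv i f))"

definition Cr_euclid :: "nat \<Rightarrow> enat \<Rightarrow> (nat \<Rightarrow> real) set \<Rightarrow> ((nat \<Rightarrow> real) \<Rightarrow> real) \<Rightarrow> bool" where
  "Cr_euclid n r W f \<longleftrightarrow> (\<forall>k. enat k \<le> r \<longrightarrow> Ck_euclid n k W f)"

type_synonym 'm chart = "'m set \<times> ('m \<Rightarrow> nat \<Rightarrow> real)"

definition is_chart :: "nat \<Rightarrow> 'm topology \<Rightarrow> 'm chart \<Rightarrow> bool" where
  "is_chart n M = (\<lambda>(V, x). openin M V \<and> openin (Euclidean_space n) (x ` V) \<and>
     homeomorphic_map (subtopology M V) (subtopology (Euclidean_space n) (x ` V)) x)"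

definition smooth_manifold :: "nat \<Rightarrow> 'm topology \<Rightarrow> 'm chart set \<Rightarrow> bool" where
  "smooth_manifold n M A \<longleftrightarrow>
     Hausdorff_space M \<and> second_countable M \<and>
     (\<forall>c\<in>A. is_chart n M c) \<and> (\<Union>(V, x)\<in>A. V) = topspace M \<and>
     (\<forall>(V, x)\<in>A. \<forall>(W, y)\<in>A. \<forall>i<n.
        Cr_euclid n \<infinity> (x ` (V \<inter> W)) (\<lambda>u. y (inv_into V x u) i))"

text \<open>
  Maps of class \<open>C\<^sup>r\<close> from an open subset \<open>U\<close> of the manifold with atlas \<open>A\<close> to \<open>\<real>\<^sup>I\<close>, for a finite
  index set \<open>I\<close>.
\<close>

definition Cr_on :: "nat \<Rightarrow> 'm chart set \<Rightarrow> enat \<Rightarrow> 'm set \<Rightarrow> 'i set \<Rightarrow> ('m \<Rightarrow> 'i \<Rightarrow> real) \<Rightarrow> bool" where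
  "Cr_on n A r U I G \<longleftrightarrow>
     (\<forall>(V, x)\<in>A. \<forall>i\<in>I. Cr_euclid n r (x ` (U \<inter> V)) (\<lambda>u. G (inv_into V x u) i))"

definition generic :: "'m topology \<Rightarrow> 'm set \<Rightarrow> bool" where
  "generic M S \<longleftrightarrow> openin M S \<and> M closure_of S = topspace M"


section \<open>Barcodes\<close>

text \<open>
  A barcode is given by its multiplicity function: the multiplicities of a finite multiset \<open>D'\<close> of
  points of \<open>\<real> \<times> (\<real> \<union> {+\<infinity>})\<close>, plus \<open>\<infinity>\<close> on the diagonal.
\<close>

definition barcode_mult :: "(real \<times> ereal) multiset \<Rightarrow> real \<times> ereal \<Rightarrow> enat" where
  "barcode_mult D' = (\<lambda>(b, d). enat (count D' (b, d)) + (if d = ereal b then \<infinity> else 0))"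

typedef barcode = "{barcode_mult D' | D'. \<forall>(b, d)\<in>#D'. d \<noteq> -\<infinity>}"
  by (auto intro: exI[of _ "{#}"])

text \<open>The barcode \<open>D' \<union> \<Delta>\<^sup>\<infinity>\<close>, meaningful when no point of \<open>D'\<close> has second coordinate \<open>-\<infinity>\<close>.\<close>

definition barcode_of :: "(real \<times> ereal) multiset \<Rightarrow> barcode" where
  "barcode_of D' = Abs_barcode (barcode_mult D')"

text \<open>
  A point \<open>(b\<^sub>1, d\<^sub>1, \<dots>, b\<^sub>m, d\<^sub>m)\<close> of \<open>\<real>\<^sup>2\<^sup>m\<close> is given by its coordinates numbered \<open>0, \<dots>, 2m - 1\<close>, so that
  \<open>b\<^sub>i\<close> and \<open>d\<^sub>i\<close> have the numbers \<open>2(i - 1)\<close> and \<open>2(i - 1) + 1\<close>.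
\<close>

definition Q :: "nat \<Rightarrow> nat \<Rightarrow> (nat \<Rightarrow> real) \<times> (nat \<Rightarrow> real) \<Rightarrow> barcode" where
  "Q m n = (\<lambda>(y, v). barcode_of
     (image_mset (\<lambda>i. (y (2 * i), ereal (y (2 * i + 1)))) (mset_set {..<m}) +
      image_mset (\<lambda>j. (v j, \<infinity>)) (mset_set {..<n})))"

definition r_differentiable_at ::
    "nat \<Rightarrow> 'm topology \<Rightarrow> 'm chart set \<Rightarrow> enat \<Rightarrow> ('m \<Rightarrow> barcode) \<Rightarrow> 'm \<Rightarrow> bool" where
  "r_differentiable_at N M A r B \<theta> \<longleftrightarrow>
     (\<exists>U m n Bt. openin M U \<and> \<theta> \<in> U \<and>
        Cr_on N A r U {..<2 * m} (\<lambda>\<theta>'. fst (Bt \<theta>')) \<and>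
        Cr_on N A r U {..<n} (\<lambda>\<theta>'. snd (Bt \<theta>')) \<and>
        (\<forall>\<theta>'\<in>U. B \<theta>' = Q m n (Bt \<theta>')))"


section \<open>Persistence modules\<close>

text \<open>
  Vector spaces over a field \<open>'k\<close> are module records of HOL-Algebra; the multiplicative fields of
  the record play no role. A persistence module is a family of vector spaces indexed by \<open>\<real>\<close> together with
  its transition maps \<open>\<phi> s t\<close>, of which only those with \<open>s \<le> t\<close> matter.
\<close>

type_synonym ('k, 'a) pmodule = "(real \<Rightarrow> ('k, 'a) module) \<times> (real \<Rightarrow> real \<Rightarrow> 'a \<Rightarrow> 'a)"

definition linear_iso :: "('k, 'a) module \<Rightarrow> ('k, 'b) module \<Rightarrow> ('a \<Rightarrow> 'b) set" where
  "linear_iso V W = {h \<in> iso (add_monoid V) (add_monoid W).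
     \<forall>a. \<forall>x\<in>carrier V. h (a \<odot>\<^bsub>V\<^esub> x) = a \<odot>\<^bsub>W\<^esub> h x}"

definition pmodule_isomorphic :: "('k, 'a) pmodule \<Rightarrow> ('k, 'b) pmodule \<Rightarrow> bool" where
  "pmodule_isomorphic P P' \<longleftrightarrow>
     (\<exists>h. (\<forall>t. h t \<in> linear_iso (fst P t) (fst P' t)) \<and>
          (\<forall>s t. s \<le> t \<longrightarrow> (\<forall>x\<in>carrier (fst P s). h t (snd P s t x) = snd P' s t (h s x))))"

definition interval_module :: "real set \<Rightarrow> ('k::field, 'k) pmodule" where
  "interval_module J =
     ((\<lambda>t. \<lparr>carrier = (if t \<in> J then UNIV else {0}), mult = undefined, one = undefined,
            zero = 0, add = (+), smult = (*)\<rparr>),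
      (\<lambda>s t x. if s \<in> J \<and> t \<in> J then x else 0))"

definition direct_sum :: "'i set \<Rightarrow> ('i \<Rightarrow> ('k, 'a) pmodule) \<Rightarrow> ('k, 'i \<Rightarrow> 'a) pmodule" where
  \<comment> \<open>for finite \<open>I\<close>\<close>
  "direct_sum I P =
     ((\<lambda>t. \<lparr>carrier = (\<Pi>\<^sub>E i\<in>I. carrier (fst (P i) t)), mult = undefined, one = undefined,
            zero = (\<lambda>i\<in>I. \<zero>\<^bsub>fst (P i) t\<^esub>),
            add = (\<lambda>x y. \<lambda>i\<in>I. x i \<oplus>\<^bsub>fst (P i) t\<^esub> y i),
            smult = (\<lambda>a x. \<lambda>i\<in>I. a \<odot>\<^bsub>fst (P i) t\<^esub> x i)\<rparr>),
      (\<lambda>s t x. \<lambda>i\<in>I. snd (P i) s t (x i)))"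

definition quotient_module :: "('k, 'a) module \<Rightarrow> 'a set \<Rightarrow> ('k, 'a set) module" where
  "quotient_module V W =
     \<lparr>carrier = a_rcosets\<^bsub>V\<^esub> W, mult = undefined, one = undefined,
      zero = W, add = (<+>\<^bsub>V\<^esub>), smult = (\<lambda>a X. \<Union>x\<in>X. W +>\<^bsub>V\<^esub> (a \<odot>\<^bsub>V\<^esub> x))\<rparr>"


section \<open>Simplicial homology and the barcode of a filter function\<close>

definition abstract_simplicial_complex :: "'v set set \<Rightarrow> bool" where
  "abstract_simplicial_complex K \<longleftrightarrow>
     (\<forall>\<sigma>\<in>K. finite \<sigma> \<and> \<sigma> \<noteq> {}) \<and> (\<forall>\<sigma>\<in>K. \<forall>\<tau>\<subseteq>\<sigma>. \<tau> \<noteq> {} \<longrightarrow> \<tau> \<in> K)"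

definition chains :: "'v set set \<Rightarrow> nat \<Rightarrow> ('v set \<Rightarrow> 'k::field) set" where
  "chains L p = {c. \<forall>\<sigma>. c \<sigma> \<noteq> 0 \<longrightarrow> \<sigma> \<in> L \<and> card \<sigma> = p + 1}"

text \<open>
  Simplices are oriented by the order of the vertices: removing the vertex \<open>v\<close> from \<open>\<sigma>\<close> comes with the
  sign \<open>(-1)\<^sup>i\<close>, where \<open>v\<close> is the \<open>i\<close>-th vertex of \<open>\<sigma>\<close>, counting from 0. The clause for the empty
  set makes the boundary of every 0-chain zero (homology is not reduced).
\<close>

definition boundary :: "'v::linorder set set \<Rightarrow> ('v set \<Rightarrow> 'k::field) \<Rightarrow> 'v set \<Rightarrow> 'k" where
  "boundary L c = (\<lambda>\<tau>. if \<tau> = {} then 0 else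
     (\<Sum>\<sigma>\<in>L. \<Sum>v | v \<in> \<sigma> \<and> \<sigma> - {v} = \<tau>. (-1) ^ card {w \<in> \<sigma>. w < v} * c \<sigma>))"

definition cycles :: "'v::linorder set set \<Rightarrow> nat \<Rightarrow> ('v set \<Rightarrow> 'k::field) set" where
  "cycles L p = {c \<in> chains L p. boundary L c = (\<lambda>_. 0)}"

definition boundaries :: "'v::linorder set set \<Rightarrow> nat \<Rightarrow> ('v set \<Rightarrow> 'k::field) set" where
  "boundaries L p = boundary L ` chains L (p + 1)"

definition cycle_module :: "'v::linorder set set \<Rightarrow> nat \<Rightarrow> ('k::field, 'v set \<Rightarrow> 'k) module" where
  "cycle_module L p =
     \<lparr>carrier = cycles L p, mult = undefined, one = undefined,
      zero = (\<lambda>_. 0), add = (\<lambda>c d \<sigma>. c \<sigma> + d \<sigma>), smult = (\<lambda>a c \<sigma>. a * c \<sigma>)\<rparr>"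

definition homology :: "'v::linorder set set \<Rightarrow> nat \<Rightarrow> ('k::field, ('v set \<Rightarrow> 'k) set) module" where
  "homology L p = quotient_module (cycle_module L p) (boundaries L p)"

text \<open>The map \<open>H\<^sub>p(L) \<rightarrow> H\<^sub>p(L')\<close> induced by an inclusion \<open>L \<subseteq> L'\<close> depends on \<open>L'\<close> only.\<close>

definition homology_map ::
    "'v::linorder set set \<Rightarrow> nat \<Rightarrow> ('v set \<Rightarrow> 'k::field) set \<Rightarrow> ('v set \<Rightarrow> 'k) set" where
  "homology_map L' p X = (\<Union>z\<in>X. boundaries L' p +>\<^bsub>cycle_module L' p\<^esub> z)"

definition filter_function :: "'v set set \<Rightarrow> ('v set \<Rightarrow> real) \<Rightarrow> bool" where
  "filter_function K f \<longleftrightarrow> (\<forall>\<sigma>\<in>K. \<forall>\<sigma>'\<in>K. \<sigma> \<subseteq> \<sigma>' \<longrightarrow> f \<sigma> \<le> f \<sigma>')"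

definition sublevel :: "'v set set \<Rightarrow> ('v set \<Rightarrow> real) \<Rightarrow> real \<Rightarrow> 'v set set" where
  "sublevel K f t = {\<sigma> \<in> K. f \<sigma> \<le> t}"

definition persistent_homology ::
    "'v::linorder set set \<Rightarrow> nat \<Rightarrow> ('v set \<Rightarrow> real) \<Rightarrow> ('k::field, ('v set \<Rightarrow> 'k) set) pmodule" where
  "persistent_homology K p f =
     ((\<lambda>t. homology (sublevel K f t) p), (\<lambda>s t. homology_map (sublevel K f t) p))"

text \<open>
  The intervals occurring below are bounded below when \<open>K\<close> is finite, because the sublevel complexes
  are empty for small \<open>t\<close>; hence the real infimum \<^term>\<open>Inf (J i)\<close> is the infimum of the interval. The
  field of coefficients is passed as a type argument.
\<close>

definition Dgm :: "'k::field itself \<Rightarrow> 'v::linorder set set \<Rightarrow> nat \<Rightarrow> ('v set \<Rightarrow> real) \<Rightarrow> barcode" where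
  "Dgm TK K p f = (THE D. \<exists>N (J :: nat \<Rightarrow> real set).
     (\<forall>i<N. is_interval (J i) \<and> J i \<noteq> {}) \<and>
     pmodule_isomorphic
       (persistent_homology K p f :: ('k, ('v set \<Rightarrow> 'k) set) pmodule)
       (direct_sum {..<N} (\<lambda>i. interval_module (J i))) \<and>
     D = barcode_of (image_mset (\<lambda>i. (Inf (J i), SUP t\<in>J i. ereal t)) (mset_set {..<N})))"


section \<open>Ordering equivalence\<close>

definition ordering_equiv :: "'v set set \<Rightarrow> ('v set \<Rightarrow> real) \<Rightarrow> ('v set \<Rightarrow> real) \<Rightarrow> bool" where
  "ordering_equiv K f g \<longleftrightarrow> (\<forall>\<sigma>\<in>K. \<forall>\<sigma>'\<in>K. f \<sigma> \<le> f \<sigma>' \<longleftrightarrow> g \<sigma> \<le> g \<sigma>')"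

definition locally_order_constant ::
    "'m topology \<Rightarrow> 'v set set \<Rightarrow> ('m \<Rightarrow> 'v set \<Rightarrow> real) \<Rightarrow> 'm set" where
  "locally_order_constant M K F =
     {\<theta> \<in> topspace M. \<exists>U. openin M U \<and> \<theta> \<in> U \<and> (\<forall>\<theta>'\<in>U. ordering_equiv K (F \<theta>') (F \<theta>))}"

end

theory Submission
  imports Defs "HOL-Library.Function_Algebras"
begin

text \<open>
  Why the theorem holds. On an open set where the order that \<open>F \<theta>\<close> induces on the simplices does not
  change, the barcode is a fixed combinatorial pattern whose endpoints are values \<open>F \<theta> \<sigma>\<close> at fixed
  simplices \<open>\<sigma>\<close>. So \<open>\<theta> \<mapsto> (F \<theta> \<sigma>)\<^sub>\<sigma>\<close>, with \<open>\<sigma>\<close> running through these endpoints, is a lift of the barcode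
  through \<^const>\<open>Q\<close>, and as a choice of coordinates of \<open>F\<close> it is as smooth as \<open>F\<close>.

  The pattern comes from linear algebra. The cycle spaces \<open>Z\<^sub>t\<close> and the boundary spaces \<open>B\<^sub>t\<close> of the sublevel
  complexes form two flags in one vector space of chains, and two flags always have a common adapted
  basis (\<open>adapted_basis_of_two_flags\<close>). A basis vector \<open>e\<close> spans a summand of \<open>H\<^sub>p(K\<^sup>t) = Z\<^sub>t / B\<^sub>t\<close>
  exactly for those \<open>t\<close> with \<open>e \<in> Z\<^sub>t\<close> and \<open>e \<notin> B\<^sub>t\<close>, so taking coefficients with respect to the basis
  decomposes persistent homology into interval modules (\<open>interval_decomposition_of_adapted_basis\<close>).
  The flags consist of the spaces of the complexes \<open>{\<tau>. f \<tau> \<le> f \<sigma>}\<close>, which depend on the preorder of \<open>f\<close>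
  only; hence one basis serves a whole ordering class, and the parameter at which \<open>e\<close> enters \<open>Z\<^sub>t\<close> or \<open>B\<^sub>t\<close>
  is the value of the filter function at one simplex (\<open>entry_time\<close>,
  \<open>interval_decomposition_over_ordering_class\<close>).

  Since \<^const>\<open>Dgm\<close> is a definite description, the decomposition must also determine the barcode. The rank of
  \<open>H\<^sub>p(K\<^sup>s) \<rightarrow> H\<^sub>p(K\<^sup>t)\<close> is the number of intervals that contain both \<open>s\<close> and \<open>t\<close>, and it is invariant
  under isomorphism (\<open>rank_at_le\<close>); the multiplicity of an off-diagonal point is recovered from these
  numbers by inclusion and exclusion near its coordinates (\<open>barcode_of_eq_if_rank_eq\<close>).

  Genericity is elementary: a strict inequality \<open>F \<theta> \<sigma> < F \<theta> \<tau>\<close> persists nearby, so a point of a given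
  open set at which the number of strict inequalities is maximal has a neighbourhood on which the
  preorder is constant (\<open>dense_locally_order_constant\<close>).
\<close>

section \<open>Bases adapted to two flags\<close>

context vector_space
begin

text \<open>
  The extension step: the new vectors are taken from \<open>W\<close> itself, so an element of \<open>W\<close> differs from a
  combination of new vectors by an element of \<open>span E \<inter> W\<close>, which is already spanned inside \<open>W\<close>.
\<close>

lemma extend_adapted_basis:
  assumes E: "independent E" and W: "subspace W" and EW: "span E \<inter> W \<subseteq> span (E \<inter> W)"
  obtains E' where "independent E'" "E \<subseteq> E'" "E' \<subseteq> E \<union> W" "W \<subseteq> span (E' \<inter> W)"
proof -
  obtain E' where E': "E \<subseteq> E'" "E' \<subseteq> E \<union> W" "independent E'" "E \<union> W \<subseteq> span E'"
    using maximal_independent_subset_extend[of E "E \<union> W"] E by blast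
  have "W \<subseteq> span (E' \<inter> W)"
  proof
    fix w assume w: "w \<in> W"
    have "span E' = span (E \<union> (E' - E))" using E'(1) by (simp add: Un_absorb1)
    with w E'(4) obtain u x where ux: "w = u + x" "u \<in> span E" "x \<in> span (E' - E)"
      unfolding span_Un by blast
    have xs: "x \<in> span (E' \<inter> W)" using ux(3) span_mono[of "E' - E" "E' \<inter> W"] E'(2) by blast
    moreover have "x \<in> W" using xs span_minimal[of "E' \<inter> W" W] W by auto
    then have "u \<in> W" using subspace_diff[OF W w, of x] ux(1) by simp
    then have "u \<in> span (E' \<inter> W)" using EW ux(2) span_mono[of "E \<inter> W" "E' \<inter> W"] E'(1) by blast
    ultimately show "w \<in> span (E' \<inter> W)" using ux(1) span_add by blast
  qed
  with E' that show ?thesis by blast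
qed

text \<open>
  A family of subspaces has a common adapted basis as soon as it can be enumerated such that each
  member meets the span of the earlier ones only in what the earlier members below it span.
\<close>

lemma adapted_basis_of_sequence:
  fixes W :: "nat \<Rightarrow> 'b set"
  assumes W: "\<And>i. i < n \<Longrightarrow> subspace (W i)"
    and new: "\<And>i. i < n \<Longrightarrow>
      W i \<inter> span (\<Union>j<i. W j) \<subseteq> span (\<Union>j\<in>{j. j < i \<and> W j \<subseteq> W i}. W j)"
  shows "\<exists>E. independent E \<and> E \<subseteq> (\<Union>i<n. W i) \<and> (\<forall>i<n. W i \<subseteq> span (E \<inter> W i))"
  using assms
proof (induction n)
  case 0
  then show ?case by (auto intro: exI[of _ "{}"] simp: independent_empty)
next
  case (Suc n)
  have "\<exists>E. independent E \<and> E \<subseteq> (\<Union>i<n. W i) \<and> (\<forall>i<n. W i \<subseteq> span (E \<inter> W i))"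
  proof (rule Suc.IH)
    show "subspace (W i)" if "i < n" for i using Suc.prems(1) that by simp
    show "W i \<inter> span (\<Union>j<i. W j) \<subseteq> span (\<Union>j\<in>{j. j < i \<and> W j \<subseteq> W i}. W j)"
      if "i < n" for i using Suc.prems(2)[of i] that by simp
  qed
  then obtain E where E: "independent E" "E \<subseteq> (\<Union>i<n. W i)"
    "\<And>i. i < n \<Longrightarrow> W i \<subseteq> span (E \<inter> W i)" by blast
  have "span E \<inter> W n \<subseteq> W n \<inter> span (\<Union>j<n. W j)" using span_mono[OF E(2)] by blast
  also have "\<dots> \<subseteq> span (\<Union>j\<in>{j. j < n \<and> W j \<subseteq> W n}. W j)" using Suc.prems(2) by blast
  also have "\<dots> \<subseteq> span (E \<inter> W n)"
  proof (rule span_minimal)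
    show "(\<Union>j\<in>{j. j < n \<and> W j \<subseteq> W n}. W j) \<subseteq> span (E \<inter> W n)"
    proof
      fix x assume "x \<in> (\<Union>j\<in>{j. j < n \<and> W j \<subseteq> W n}. W j)"
      then obtain j where "j < n" "W j \<subseteq> W n" "x \<in> W j" by blast
      then show "x \<in> span (E \<inter> W n)"
        using E(3)[of j] span_mono[of "E \<inter> W j" "E \<inter> W n"] by blast
    qed
  qed (rule subspace_span)
  finally obtain E' where E': "independent E'" "E \<subseteq> E'" "E' \<subseteq> E \<union> W n" "W n \<subseteq> span (E' \<inter> W n)"
    using extend_adapted_basis[OF E(1) Suc.prems(1)[OF lessI]] by blast
  have "W i \<subseteq> span (E' \<inter> W i)" if "i < Suc n" for i
  proof (cases "i = n")
    case False
    then show ?thesis using E(3)[of i] span_mono[of "E \<inter> W i" "E' \<inter> W i"] E'(2) that by fastforce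
  qed (use E'(4) in simp)
  moreover have "E' \<subseteq> (\<Union>i<Suc n. W i)" using E'(3) E(2) by (force simp: lessThan_Suc)
  ultimately show ?case using E'(1) by blast
qed

text \<open>
  The intersections \<open>Z\<^sub>k \<inter> B\<^sub>l\<close> are enumerated lexicographically: the pair \<open>(k, l)\<close> has number
  \<open>k * (m + 1) + l\<close>. What precedes it spans at most \<open>Z\<^sub>k\<^sub>-\<^sub>1 + Z\<^sub>k \<inter> B\<^sub>l\<^sub>-\<^sub>1\<close>, and by the modular law this
  meets \<open>Z\<^sub>k \<inter> B\<^sub>l\<close> in \<open>Z\<^sub>k\<^sub>-\<^sub>1 \<inter> B\<^sub>l + Z\<^sub>k \<inter> B\<^sub>l\<^sub>-\<^sub>1\<close>. As both flags end in the whole space, the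
  \<open>Z\<^sub>k\<close> and the \<open>B\<^sub>l\<close> are themselves among the intersections.
\<close>

lemma adapted_basis_of_two_flags:
  fixes Z B :: "nat \<Rightarrow> 'b set"
  assumes Z: "\<And>i. subspace (Z i)" "mono Z" and B: "\<And>i. subspace (B i)" "mono B"
    and top: "Z m = UNIV" "B m = UNIV"
  obtains E where "independent E" "\<And>i. i \<le> m \<Longrightarrow> Z i \<subseteq> span (E \<inter> Z i)"
    "\<And>i. i \<le> m \<Longrightarrow> B i \<subseteq> span (E \<inter> B i)"
proof -
  define M where "M = Suc m"
  define W where "W i = Z (i div M) \<inter> B (i mod M)" for i
  have M: "M > 0" by (simp add: M_def)
  have Zm: "Z i \<subseteq> Z j" "B i \<subseteq> B j" if "i \<le> j" for i j using Z(2) B(2) that by (auto dest: monoD)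
  have Wkl: "W (k * M + l) = Z k \<inter> B l" if "l < M" for k l using that by (simp add: W_def)
  have subW: "subspace (W i)" for i by (simp add: W_def Z(1) B(1) subspace_inter)
  have "W i \<inter> span (\<Union>j<i. W j) \<subseteq> span (\<Union>j\<in>{j. j < i \<and> W j \<subseteq> W i}. W j)" for i
  proof
    fix v assume v: "v \<in> W i \<inter> span (\<Union>j<i. W j)"
    define k l where "k = i div M" and "l = i mod M"
    have i: "i = k * M + l" and l: "l < M" by (auto simp: k_def l_def M)
    \<comment> \<open>\<open>S1\<close> and \<open>S2\<close> stand for \<open>Z\<^sub>k\<^sub>-\<^sub>1\<close> and \<open>Z\<^sub>k \<inter> B\<^sub>l\<^sub>-\<^sub>1\<close>, read as zero when the index would be negative.\<close>
    define S1 where "S1 = (if k = 0 then {0} else Z (k - 1))"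
    define S2 where "S2 = (if l = 0 then {0} else Z k \<inter> B (l - 1))"
    have S: "subspace S1" "subspace S2"
      by (auto simp: S1_def S2_def Z(1) B(1) subspace_inter subspace_single_0)
    have "(\<Union>j<i. W j) \<subseteq> S1 \<union> S2"
    proof
      fix x assume "x \<in> (\<Union>j<i. W j)"
      then obtain j where j: "j < i" "x \<in> Z (j div M)" "x \<in> B (j mod M)" by (auto simp: W_def)
      have "j div M \<le> k" using j(1) unfolding k_def by (simp add: div_le_mono)
      then consider "j div M < k" | "j div M = k" by linarith
      then show "x \<in> S1 \<union> S2"
      proof cases
        case 1
        then have "j div M \<le> k - 1" by linarith
        then show ?thesis using 1 j(2) Zm(1)[of "j div M" "k - 1"] by (auto simp: S1_def)
      next
        case 2
        then have "j mod M < l"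
          using j(1) i by (metis div_mult_mod_eq nat_add_left_cancel_less)
        moreover from this have "j mod M \<le> l - 1" by linarith
        ultimately show ?thesis using 2 j Zm(2)[of "j mod M" "l - 1"] by (auto simp: S2_def)
      qed
    qed
    then have "v \<in> span (S1 \<union> S2)" using v span_mono by blast
    then obtain z y where zy: "v = z + y" "z \<in> S1" "y \<in> S2"
      unfolding span_Un using S by (auto simp: span_eq_iff[THEN iffD2])
    have y: "y \<in> span (\<Union>j\<in>{j. j < i \<and> W j \<subseteq> W i}. W j)"
    proof (cases "l = 0")
      case True
      then show ?thesis using zy(3) by (simp add: S2_def span_zero)
    next
      case False
      then have "W (k * M + (l - 1)) = Z k \<inter> B (l - 1)" using Wkl[of "l - 1"] l by simp
      moreover have "k * M + (l - 1) < i" using False by (simp add: i)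
      moreover have "Z k \<inter> B (l - 1) \<subseteq> W i" using Wkl[OF l, of k] Zm(2)[of "l - 1" l] i by auto
      moreover have "y \<in> Z k \<inter> B (l - 1)" using zy(3) False by (simp add: S2_def)
      ultimately show ?thesis by (intro span_base) blast
    qed
    have z: "z \<in> span (\<Union>j\<in>{j. j < i \<and> W j \<subseteq> W i}. W j)"
    proof (cases "k = 0")
      case True
      then show ?thesis using zy(2) by (simp add: S1_def span_zero)
    next
      case False
      have "y \<in> B l" using zy(3) Zm(2)[of "l - 1" l] subspace_0[OF B(1)] by (auto simp: S2_def split: if_splits)
      moreover have "v \<in> B l" using v by (simp add: W_def l_def)
      ultimately have "z \<in> B l" using subspace_diff[OF B(1), of v l y] zy(1) by simp
      moreover have "W ((k - 1) * M + l) = Z (k - 1) \<inter> B l" using Wkl[OF l] .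
      moreover have "(k - 1) * M + l < i" using False M by (simp add: i)
      moreover have "Z (k - 1) \<inter> B l \<subseteq> W i" using Wkl[OF l, of k] Zm(1)[of "k - 1" k] i by auto
      moreover have "z \<in> Z (k - 1)" using zy(2) False by (simp add: S1_def)
      ultimately show ?thesis by (intro span_base) blast
    qed
    show "v \<in> span (\<Union>j\<in>{j. j < i \<and> W j \<subseteq> W i}. W j)" using span_add[OF z y] zy(1) by simp
  qed
  with adapted_basis_of_sequence[of "M * M" W] subW
  obtain E where E: "independent E" "\<And>i. i < M * M \<Longrightarrow> W i \<subseteq> span (E \<inter> W i)" by blast
  have "Z k \<inter> B l \<subseteq> span (E \<inter> (Z k \<inter> B l))" if "k < M" "l < M" for k l
  proof -
    have "k * M + l < M * M"
      using that mult_le_mono1[of "Suc k" M M] by (simp add: Suc_le_eq)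
    then show ?thesis using E(2)[of "k * M + l"] Wkl[OF that(2), of k] by simp
  qed
  from this[of _ m] this[of m] show ?thesis using that E(1) top by (simp add: M_def)
qed

text \<open>
  This is how adaptedness is used: membership in an adapted subspace can be read off coordinates.
\<close>

lemma mem_subspace_iff_representation:
  assumes E: "independent E" and W: "subspace W" "W \<subseteq> span (E \<inter> W)" and v: "v \<in> span E"
  shows "v \<in> W \<longleftrightarrow> (\<forall>e. representation E v e \<noteq> 0 \<longrightarrow> e \<in> W)"
proof
  assume "v \<in> W"
  then have "representation E v = representation (E \<inter> W) v"
    using W(2) by (intro representation_extend E) auto
  then show "\<forall>e. representation E v e \<noteq> 0 \<longrightarrow> e \<in> W" by (auto dest: representation_ne_zero)
next
  assume "\<forall>e. representation E v e \<noteq> 0 \<longrightarrow> e \<in> W"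
  then have "(\<Sum>e | representation E v e \<noteq> 0. representation E v e *s e) \<in> W"
    by (intro subspace_sum[OF W(1)] subspace_scale[OF W(1)]) auto
  then show "v \<in> W" using sum_nonzero_representation_eq[OF E v] by simp
qed

end

section \<open>Spaces of functions\<close>

definition scale_fun :: "'k::field \<Rightarrow> ('a \<Rightarrow> 'k) \<Rightarrow> 'a \<Rightarrow> 'k" where
  "scale_fun a x = (\<lambda>i. a * x i)"

interpretation fun_space: vector_space scale_fun
  by standard (auto simp: scale_fun_def algebra_simps)

lemma sum_fun_apply: "sum f A i = (\<Sum>x\<in>A. f x i)"
  for f :: "'b \<Rightarrow> 'a \<Rightarrow> 'k::comm_monoid_add"
  by (induction A rule: infinite_finite_induct) auto

definition unit_fun :: "'a \<Rightarrow> 'a \<Rightarrow> 'k::field" where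
  "unit_fun i = (\<lambda>j. if j = i then 1 else 0)"

lemma inj_unit_fun: "inj unit_fun"
  by (auto simp: inj_def unit_fun_def fun_eq_iff split: if_splits)

lemma span_unit_fun:
  assumes "finite S"
  shows "fun_space.span (unit_fun ` S) = {x :: 'a \<Rightarrow> 'k::field. \<forall>i. i \<notin> S \<longrightarrow> x i = 0}"
proof
  have "fun_space.subspace {x :: 'a \<Rightarrow> 'k. \<forall>i. i \<notin> S \<longrightarrow> x i = 0}"
    by (auto simp: fun_space.subspace_def scale_fun_def)
  then show "fun_space.span (unit_fun ` S) \<subseteq> {x :: 'a \<Rightarrow> 'k. \<forall>i. i \<notin> S \<longrightarrow> x i = 0}"
    by (intro fun_space.span_minimal) (auto simp: unit_fun_def)
  show "{x :: 'a \<Rightarrow> 'k. \<forall>i. i \<notin> S \<longrightarrow> x i = 0} \<subseteq> fun_space.span (unit_fun ` S)"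
  proof
    fix x :: "'a \<Rightarrow> 'k" assume x: "x \<in> {x. \<forall>i. i \<notin> S \<longrightarrow> x i = 0}"
    have "x = (\<Sum>i\<in>S. scale_fun (x i) (unit_fun i))"
    proof
      fix j
      have "(\<Sum>i\<in>S. scale_fun (x i) (unit_fun i)) j = (\<Sum>i\<in>S. if j = i then x i else 0)"
        by (auto simp: sum_fun_apply scale_fun_def unit_fun_def intro!: sum.cong)
      also have "\<dots> = x j" using assms x by (auto simp: sum.delta)
      finally show "x j = (\<Sum>i\<in>S. scale_fun (x i) (unit_fun i)) j" by simp
    qed
    also have "\<dots> \<in> fun_space.span (unit_fun ` S)"
      by (intro fun_space.span_sum fun_space.span_scale fun_space.span_base) auto
    finally show "x \<in> fun_space.span (unit_fun ` S)" .
  qed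
qed

lemma independent_unit_fun:
  assumes "finite S"
  shows "fun_space.independent (unit_fun ` S :: ('a \<Rightarrow> 'k::field) set)"
  using assms
proof (induction S)
  case (insert i S)
  then have "unit_fun i \<notin> fun_space.span (unit_fun ` S :: ('a \<Rightarrow> 'k) set)"
    unfolding span_unit_fun[OF insert.hyps(1)] by (auto simp: unit_fun_def intro!: exI[of _ i])
  then show ?case using insert.IH by (simp add: fun_space.independent_insert)
qed (simp add: fun_space.independent_empty)

text \<open>
  Monotonicity of dimension for the spaces \<open>k\<^sup>S\<close> and \<open>k\<^sup>S\<^sup>'\<close>, realised as functions on larger index types that
  vanish off \<open>S\<close> and \<open>S'\<close>, so that \<open>G\<close> can be a total linear map.
\<close>

lemma card_le_if_linear_injective:
  fixes G :: "('a \<Rightarrow> 'k::field) \<Rightarrow> 'b \<Rightarrow> 'k"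
  assumes fin: "finite S" "finite S'"
    and add: "\<And>x y. G (x + y) = G x + G y" and scale: "\<And>a x. G (scale_fun a x) = scale_fun a (G x)"
    and inj: "inj_on G {x. \<forall>i. i \<notin> S \<longrightarrow> x i = 0}"
    and supp: "\<And>x k. k \<notin> S' \<Longrightarrow> G x k = 0"
  shows "card S \<le> card S'"
proof -
  interpret vector_space_pair "scale_fun :: 'k \<Rightarrow> ('a \<Rightarrow> 'k) \<Rightarrow> _" "scale_fun :: 'k \<Rightarrow> ('b \<Rightarrow> 'k) \<Rightarrow> _"
    by unfold_locales
  let ?B = "unit_fun ` S :: ('a \<Rightarrow> 'k) set" and ?B' = "unit_fun ` S' :: ('b \<Rightarrow> 'k) set"
  have lin: "Vector_Spaces.linear scale_fun scale_fun G"
    by (simp add: Vector_Spaces.linear_iff fun_space.vector_space_axioms add scale)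
  have injB: "inj_on G (fun_space.span ?B)" using inj by (simp add: span_unit_fun[OF fin(1)])
  have "fun_space.independent (G ` ?B)"
    by (rule linear_independent_injective_image[OF lin independent_unit_fun[OF fin(1)] injB])
  moreover have "G ` ?B \<subseteq> fun_space.span ?B'"
    unfolding span_unit_fun[OF fin(2)] using supp by auto
  ultimately have "card (G ` ?B) \<le> card ?B'"
    using fun_space.independent_span_bound[of ?B' "G ` ?B"] fin(2) by simp
  moreover have "card (G ` ?B) = card ?B"
    using injB fun_space.span_superset[of ?B] by (intro card_image) (rule inj_on_subset)
  moreover have "card ?B = card S" "card ?B' = card S'"
    using inj_unit_fun by (auto intro!: card_image intro: inj_on_subset)
  ultimately show ?thesis by simp
qed

section \<open>Barcodes\<close>

text \<open>
  Up to its endpoints an interval is determined by the barcode point that it contributes.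
\<close>

lemma interval_cases:
  fixes J :: "real set"
  assumes J: "is_interval J" "J \<noteq> {}" "bdd_below J"
  obtains (unbounded) "(SUP t\<in>J. ereal t) = \<infinity>" "{Inf J<..} \<subseteq> J" "J \<subseteq> {Inf J..}"
  | (bounded) u where "(SUP t\<in>J. ereal t) = ereal u" "Inf J \<le> u" "{Inf J<..<u} \<subseteq> J" "J \<subseteq> {Inf J..u}"
proof (cases "bdd_above J")
  case True
  have "(SUP t\<in>J. ereal t) = ereal (Sup J)"
  proof (rule ereal_Sup[symmetric])
    obtain x where x: "x \<in> J" using J(2) by blast
    have "ereal x \<le> (SUP t\<in>J. ereal t)" using x by (rule SUP_upper)
    moreover have "(SUP t\<in>J. ereal t) \<le> ereal (Sup J)"
      using True by (intro SUP_least) (simp add: cSup_upper)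
    ultimately show "\<bar>SUP t\<in>J. ereal t\<bar> \<noteq> \<infinity>" by (cases "SUP t\<in>J. ereal t") auto
  qed
  moreover have "x \<in> J" if x: "Inf J < x" "x < Sup J" for x
  proof -
    obtain y z where "y \<in> J" "y < x" "z \<in> J" "x < z"
      using x J(2,3) True by (metis cInf_less_iff less_cSup_iff)
    then show ?thesis using J(1) by (meson less_imp_le mem_is_interval_1_I)
  qed
  ultimately show ?thesis
    using cInf_le_cSup[OF J(2) True J(3)] J(3) True
    by (intro bounded[of "Sup J"]) (auto intro: cInf_lower cSup_upper)
next
  case False
  have "(SUP t\<in>J. ereal t) = \<infinity>"
  proof (rule SUP_PInfty)
    fix n :: nat
    show "\<exists>i\<in>J. ereal (real n) \<le> ereal i"
      using False unfolding bdd_above_def by (auto simp: not_le intro: less_imp_le)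
  qed
  moreover have "x \<in> J" if x: "Inf J < x" for x
  proof -
    obtain y z where "y \<in> J" "y < x" "z \<in> J" "x < z"
      using x J(2,3) False unfolding bdd_above_def by (metis cInf_less_iff not_le)
    then show ?thesis using J(1) by (meson less_imp_le mem_is_interval_1_I)
  qed
  ultimately show ?thesis using J(3) by (intro unbounded) (auto intro: cInf_lower)
qed

text \<open>
  At a parameter close to \<open>b\<close>, but different from it, or close to \<open>+\<infinity>\<close>, it does not matter whether \<open>J\<close>
  contains its endpoints; membership is a condition on the point \<open>(Inf J, e)\<close> alone. The parameters
  close to \<open>+\<infinity>\<close> are written \<open>inverse \<epsilon>\<close>, so that one small \<open>\<epsilon>\<close> serves all of them.
\<close>

lemma eventually_mem_interval:
  fixes J :: "real set" and b :: real
  assumes J: "is_interval J" "J \<noteq> {}" "bdd_below J"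
  defines "e \<equiv> (SUP t\<in>J. ereal t)"
  shows "\<forall>\<^sub>F \<epsilon> in at_right 0. b + \<epsilon> \<in> J \<longleftrightarrow> Inf J \<le> b \<and> ereal b < e" (is ?R)
    and "\<forall>\<^sub>F \<epsilon> in at_right 0. b - \<epsilon> \<in> J \<longleftrightarrow> Inf J < b \<and> ereal b \<le> e" (is ?L)
    and "\<forall>\<^sub>F \<epsilon> in at_right 0. inverse \<epsilon> \<in> J \<longleftrightarrow> e = \<infinity>" (is ?T)
proof -
  define a where "a = Inf J"
  have pos: "\<forall>\<^sub>F \<epsilon> in at_right 0. (\<epsilon>::real) > 0" by (simp add: eventually_at_right_less)
  have small: "\<forall>\<^sub>F \<epsilon> in at_right 0. c > 0 \<longrightarrow> \<epsilon> < c" for c :: real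
    by (cases "c > 0") (auto intro: eventually_at_rightI[of 0 c])
  have large: "\<forall>\<^sub>F \<epsilon> in at_right 0. inverse \<epsilon> > c" for c :: real
    using filterlim_inverse_at_top_right by (auto simp: filterlim_at_top_dense)
  show ?R
    using J
  proof (cases rule: interval_cases)
    case unbounded
    from pos small[of "a - b"] show ?thesis
      by eventually_elim (use unbounded in \<open>auto simp: e_def a_def subset_eq\<close>)
  next
    case (bounded u)
    from pos small[of "a - b"] small[of "u - b"] show ?thesis
      by eventually_elim (use bounded in \<open>auto simp: e_def a_def subset_eq\<close>)
  qed
  show ?L
    using J
  proof (cases rule: interval_cases)
    case unbounded
    from pos small[of "b - a"] show ?thesis
      by eventually_elim (use unbounded in \<open>auto simp: e_def a_def subset_eq\<close>)
  next
    case (bounded u)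
    from pos small[of "b - a"] small[of "b - u"] show ?thesis
      by eventually_elim (use bounded in \<open>auto simp: e_def a_def subset_eq\<close>)
  qed
  show ?T
    using J
  proof (cases rule: interval_cases)
    case unbounded
    from large[of a] show ?thesis
      by eventually_elim (use unbounded in \<open>auto simp: e_def a_def subset_eq\<close>)
  next
    case (bounded u)
    from large[of u] show ?thesis
      by eventually_elim (use bounded in \<open>auto simp: e_def a_def subset_eq\<close>)
  qed
qed

text \<open>
  For a direct sum of interval modules over the \<open>J i\<close>, this is the rank of the transition map from
  \<open>s\<close> to \<open>t\<close>.
\<close>

definition rank_at :: "nat \<Rightarrow> (nat \<Rightarrow> real set) \<Rightarrow> real \<Rightarrow> real \<Rightarrow> nat" where
  "rank_at N J s t = card {i. i < N \<and> s \<in> J i \<and> t \<in> J i}"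

lemma rank_at_diff:
  assumes J: "\<And>i. i < N \<Longrightarrow> is_interval (J i)" and st: "s \<le> s'" "s' \<le> t"
  shows "rank_at N J s' t - rank_at N J s t = card {i. i < N \<and> s' \<in> J i \<and> t \<in> J i \<and> s \<notin> J i}"
proof -
  have "s' \<in> J i" if "i < N" "s \<in> J i" "t \<in> J i" for i
    using J[OF that(1)] that st by (meson mem_is_interval_1_I)
  then have "{i. i < N \<and> s \<in> J i \<and> t \<in> J i} \<subseteq> {i. i < N \<and> s' \<in> J i \<and> t \<in> J i}" by blast
  then have "rank_at N J s' t - rank_at N J s t
    = card ({i. i < N \<and> s' \<in> J i \<and> t \<in> J i} - {i. i < N \<and> s \<in> J i \<and> t \<in> J i})"
    unfolding rank_at_def by (subst card_Diff_subset) auto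
  also have "{i. i < N \<and> s' \<in> J i \<and> t \<in> J i} - {i. i < N \<and> s \<in> J i \<and> t \<in> J i}
    = {i. i < N \<and> s' \<in> J i \<and> t \<in> J i \<and> s \<notin> J i}" by blast
  finally show ?thesis .
qed

text \<open>
  The inner differences count the intervals that begin at \<open>b\<close> and last until \<open>d\<close>, respectively until
  after \<open>d\<close>; their difference counts those that end at \<open>d\<close>.
\<close>

lemma eventually_count_bounded:
  assumes J: "\<forall>i<N. is_interval (J i) \<and> J i \<noteq> {} \<and> bdd_below (J i)" and bd: "b < d"
  shows "\<forall>\<^sub>F \<epsilon> in at_right 0. card {i. i < N \<and> Inf (J i) = b \<and> (SUP t\<in>J i. ereal t) = ereal d} =
    (rank_at N J (b + \<epsilon>) (d - \<epsilon>) - rank_at N J (b - \<epsilon>) (d - \<epsilon>)) -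
    (rank_at N J (b + \<epsilon>) (d + \<epsilon>) - rank_at N J (b - \<epsilon>) (d + \<epsilon>))"
proof -
  have small: "\<forall>\<^sub>F \<epsilon> in at_right 0. 0 < \<epsilon> \<and> \<epsilon> < (d - b) / 2"
    using bd by (intro eventually_at_rightI[of 0 "(d - b) / 2"]) auto
  have ev: "\<forall>\<^sub>F \<epsilon> in at_right 0. \<forall>i\<in>{..<N}.
    (b + \<epsilon> \<in> J i \<longleftrightarrow> Inf (J i) \<le> b \<and> ereal b < (SUP t\<in>J i. ereal t)) \<and>
    (b - \<epsilon> \<in> J i \<longleftrightarrow> Inf (J i) < b \<and> ereal b \<le> (SUP t\<in>J i. ereal t)) \<and>
    (d + \<epsilon> \<in> J i \<longleftrightarrow> Inf (J i) \<le> d \<and> ereal d < (SUP t\<in>J i. ereal t)) \<and>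
    (d - \<epsilon> \<in> J i \<longleftrightarrow> Inf (J i) < d \<and> ereal d \<le> (SUP t\<in>J i. ereal t))"
    using J by (intro eventually_ball_finite ballI eventually_conj eventually_mem_interval) auto
  from small ev show ?thesis
  proof eventually_elim
    case (elim \<epsilon>)
    have tr: "ereal b < x" if "ereal d \<le> x" for x using bd that by (meson ereal_less(2) less_ereal.simps(1) order_less_le_trans)
    let ?A = "{i. i < N \<and> b + \<epsilon> \<in> J i \<and> d - \<epsilon> \<in> J i \<and> b - \<epsilon> \<notin> J i}"
    let ?B = "{i. i < N \<and> b + \<epsilon> \<in> J i \<and> d + \<epsilon> \<in> J i \<and> b - \<epsilon> \<notin> J i}"
    have A: "?A = {i. i < N \<and> Inf (J i) = b \<and> ereal d \<le> (SUP t\<in>J i. ereal t)}"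
      using elim(2) bd tr by (auto intro: less_imp_le)
    have B: "?B = {i. i < N \<and> Inf (J i) = b \<and> ereal d < (SUP t\<in>J i. ereal t)}"
      using elim(2) bd tr by (auto intro: less_imp_le)
    have "card ?A - card ?B = card (?A - ?B)"
      by (subst card_Diff_subset) (auto simp: A B)
    also have "?A - ?B = {i. i < N \<and> Inf (J i) = b \<and> (SUP t\<in>J i. ereal t) = ereal d}"
      unfolding A B by auto
    finally have "card {i. i < N \<and> Inf (J i) = b \<and> (SUP t\<in>J i. ereal t) = ereal d} = card ?A - card ?B"
      by simp
    moreover have "rank_at N J (b + \<epsilon>) (d - \<epsilon>) - rank_at N J (b - \<epsilon>) (d - \<epsilon>) = card ?A"
      using J elim(1) by (intro rank_at_diff) (auto simp: field_simps)
    moreover have "rank_at N J (b + \<epsilon>) (d + \<epsilon>) - rank_at N J (b - \<epsilon>) (d + \<epsilon>) = card ?B"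
      using J elim(1) bd by (intro rank_at_diff) (auto simp: field_simps)
    ultimately show ?case by simp
  qed
qed

lemma eventually_count_unbounded:
  assumes J: "\<forall>i<N. is_interval (J i) \<and> J i \<noteq> {} \<and> bdd_below (J i)"
  shows "\<forall>\<^sub>F \<epsilon> in at_right 0. card {i. i < N \<and> Inf (J i) = b \<and> (SUP t\<in>J i. ereal t) = \<infinity>} =
    rank_at N J (b + \<epsilon>) (inverse \<epsilon>) - rank_at N J (b - \<epsilon>) (inverse \<epsilon>)"
proof -
  define e where "e i = (SUP t\<in>J i. ereal t)" for i
  have small: "\<forall>\<^sub>F \<epsilon> in at_right 0. 0 < \<epsilon> \<and> \<epsilon> < (1::real)"
    by (intro eventually_at_rightI[of 0 1]) auto
  have large: "\<forall>\<^sub>F \<epsilon> in at_right 0. inverse \<epsilon> > b + 1"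
    using filterlim_inverse_at_top_right by (auto simp: filterlim_at_top_dense)
  have ev: "\<forall>\<^sub>F \<epsilon> in at_right 0. \<forall>i\<in>{..<N}.
    (b + \<epsilon> \<in> J i \<longleftrightarrow> Inf (J i) \<le> b \<and> ereal b < e i) \<and>
    (b - \<epsilon> \<in> J i \<longleftrightarrow> Inf (J i) < b \<and> ereal b \<le> e i) \<and>
    (inverse \<epsilon> \<in> J i \<longleftrightarrow> e i = \<infinity>)"
    using J unfolding e_def by (intro eventually_ball_finite ballI eventually_conj eventually_mem_interval) auto
  from small large ev show ?thesis
    unfolding e_def[symmetric]
  proof eventually_elim
    case (elim \<epsilon>)
    have "{i. i < N \<and> b + \<epsilon> \<in> J i \<and> inverse \<epsilon> \<in> J i \<and> b - \<epsilon> \<notin> J i}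
      = {i. i < N \<and> Inf (J i) = b \<and> e i = \<infinity>}"
    proof (rule Collect_cong, rule conj_cong[OF refl])
      fix i assume "i < N"
      then have *: "b + \<epsilon> \<in> J i \<longleftrightarrow> Inf (J i) \<le> b \<and> ereal b < e i"
        "b - \<epsilon> \<in> J i \<longleftrightarrow> Inf (J i) < b \<and> ereal b \<le> e i" "inverse \<epsilon> \<in> J i \<longleftrightarrow> e i = \<infinity>"
        using elim(3) by blast+
      show "(b + \<epsilon> \<in> J i \<and> inverse \<epsilon> \<in> J i \<and> b - \<epsilon> \<notin> J i) = (Inf (J i) = b \<and> e i = \<infinity>)"
        unfolding * by (cases "e i") auto
    qed
    moreover have "rank_at N J (b + \<epsilon>) (inverse \<epsilon>) - rank_at N J (b - \<epsilon>) (inverse \<epsilon>)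
      = card {i. i < N \<and> b + \<epsilon> \<in> J i \<and> inverse \<epsilon> \<in> J i \<and> b - \<epsilon> \<notin> J i}"
      using J elim(1,2) by (intro rank_at_diff) auto
    ultimately show ?case by simp
  qed
qed

text \<open>
  On the diagonal both barcodes have infinite multiplicity, below it they have no points, and above
  it the multiplicities are expressed through the ranks. The first family inherits boundedness below from the second one,
  because the rank at \<open>(t, t)\<close> vanishes for \<open>t\<close> far to the left.
\<close>

lemma barcode_of_eq_if_rank_eq:
  assumes J: "\<And>i. i < N \<Longrightarrow> is_interval (J i) \<and> J i \<noteq> {}"
    and J': "\<forall>i<N'. is_interval (J' i) \<and> J' i \<noteq> {} \<and> bdd_below (J' i)"
    and rank: "\<And>s t. s \<le> t \<Longrightarrow> rank_at N J s t = rank_at N' J' s t"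
  shows "barcode_of (image_mset (\<lambda>i. (Inf (J i), SUP t\<in>J i. ereal t)) (mset_set {..<N}))
    = barcode_of (image_mset (\<lambda>i. (Inf (J' i), SUP t\<in>J' i. ereal t)) (mset_set {..<N'}))"
proof -
  have bdd: "bdd_below (J i)" if i: "i < N" for i
  proof (rule ccontr)
    assume "\<not> bdd_below (J i)"
    have "bdd_below (\<Union>i<N'. J' i)" using J' by (simp add: bdd_below_UN)
    then obtain c where c: "\<And>i x. i < N' \<Longrightarrow> x \<in> J' i \<Longrightarrow> c \<le> x" by (auto simp: bdd_below_def)
    obtain t where t: "t \<in> J i" "t < c"
      using \<open>\<not> bdd_below (J i)\<close> unfolding bdd_below_def by (meson not_le)
    then have "{i. i < N' \<and> t \<in> J' i \<and> t \<in> J' i} = {}" using c by fastforce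
    then have "rank_at N' J' t t = 0" by (simp only: rank_at_def card.empty)
    moreover have "rank_at N J t t > 0" using t(1) i by (auto simp: rank_at_def card_gt_0_iff)
    ultimately show False using rank[of t t] by simp
  qed
  have J: "\<forall>i<N. is_interval (J i) \<and> J i \<noteq> {} \<and> bdd_below (J i)" using J bdd by simp
  have cnt: "count (image_mset f (mset_set {..<n})) x = card {i. i < n \<and> f i = x}"
    for f :: "nat \<Rightarrow> real \<times> ereal" and n x
    by (simp add: count_image_mset') (metis lessThan_iff)
  have "card {i. i < N \<and> Inf (J i) = b \<and> (SUP t\<in>J i. ereal t) = d}
    = card {i. i < N' \<and> Inf (J' i) = b \<and> (SUP t\<in>J' i. ereal t) = d}" if d: "d \<noteq> ereal b" for b d
  proof (cases "ereal b < d")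
    case False
    have *: "{i. i < n \<and> Inf (I i) = b \<and> (SUP t\<in>I i. ereal t) = d} = {}"
      if I: "\<forall>i<n. is_interval (I i) \<and> I i \<noteq> {} \<and> bdd_below (I i)"
      for n and I :: "nat \<Rightarrow> real set"
    proof -
      have "ereal (Inf (I i)) \<le> (SUP t\<in>I i. ereal t)" if "i < n" for i
      proof (rule interval_cases[of "I i"])
        show "is_interval (I i)" "I i \<noteq> {}" "bdd_below (I i)" using I that by auto
      qed auto
      then show ?thesis using False d by (auto simp: order_less_le)
    qed
    show ?thesis by (simp only: *[of N J, OF J] *[of N' J', OF J'])
  next
    case True
    then consider u where "d = ereal u" "b < u" | "d = \<infinity>" by (cases d) auto
    then show ?thesis
    proof cases
      case 1
      have small: "\<forall>\<^sub>F \<epsilon> in at_right 0. 0 < \<epsilon> \<and> \<epsilon> < (u - b) / 2"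
        using 1 by (intro eventually_at_rightI[of 0 "(u - b) / 2"]) auto
      from small eventually_count_bounded[OF J 1(2)] eventually_count_bounded[OF J' 1(2)]
      have "\<forall>\<^sub>F \<epsilon> in at_right (0::real). card {i. i < N \<and> Inf (J i) = b \<and> (SUP t\<in>J i. ereal t) = d}
        = card {i. i < N' \<and> Inf (J' i) = b \<and> (SUP t\<in>J' i. ereal t) = d}"
      proof eventually_elim
        case (elim \<epsilon>)
        then show ?case unfolding 1(1) by (simp only: elim(2,3)) (simp add: rank field_simps)
      qed
      then show ?thesis by (simp add: eventually_const_iff)
    next
      case 2
      have small: "\<forall>\<^sub>F \<epsilon> in at_right 0. 0 < \<epsilon> \<and> \<epsilon> < (1::real)"
        by (intro eventually_at_rightI[of 0 1]) auto
      have large: "\<forall>\<^sub>F \<epsilon> in at_right 0. inverse \<epsilon> > b + 1"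
        using filterlim_inverse_at_top_right by (auto simp: filterlim_at_top_dense)
      from small large eventually_count_unbounded[OF J, of b] eventually_count_unbounded[OF J', of b]
      have "\<forall>\<^sub>F \<epsilon> in at_right (0::real). card {i. i < N \<and> Inf (J i) = b \<and> (SUP t\<in>J i. ereal t) = d}
        = card {i. i < N' \<and> Inf (J' i) = b \<and> (SUP t\<in>J' i. ereal t) = d}"
      proof eventually_elim
        case (elim \<epsilon>)
        then show ?case unfolding 2(1) by (simp only: elim(3,4)) (simp add: rank)
      qed
      then show ?thesis by (simp add: eventually_const_iff)
    qed
  qed
  then show ?thesis
    unfolding barcode_of_def barcode_mult_def
    by (intro arg_cong[of _ _ Abs_barcode] ext) (auto simp: cnt split: prod.splits)
qed

section \<open>Invariance of the rank\<close>

text \<open>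
  The closure properties of vector spaces and linear transition maps that the transport of
  structure along isomorphisms relies on.
\<close>

definition pmodule_closed :: "('k, 'a) pmodule \<Rightarrow> bool" where
  "pmodule_closed P \<longleftrightarrow>
    (\<forall>t. \<forall>x\<in>carrier (fst P t). \<forall>y\<in>carrier (fst P t). x \<oplus>\<^bsub>fst P t\<^esub> y \<in> carrier (fst P t)) \<and>
    (\<forall>t a. \<forall>x\<in>carrier (fst P t). a \<odot>\<^bsub>fst P t\<^esub> x \<in> carrier (fst P t)) \<and>
    (\<forall>s t. s \<le> t \<longrightarrow> (\<forall>x\<in>carrier (fst P s). snd P s t x \<in> carrier (fst P t)))"

lemma linear_isoD:
  assumes "h \<in> linear_iso V W"
  shows "bij_betw h (carrier V) (carrier W)"
    and "\<And>x y. x \<in> carrier V \<Longrightarrow> y \<in> carrier V \<Longrightarrow> h (x \<oplus>\<^bsub>V\<^esub> y) = h x \<oplus>\<^bsub>W\<^esub> h y"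
    and "\<And>a x. x \<in> carrier V \<Longrightarrow> h (a \<odot>\<^bsub>V\<^esub> x) = a \<odot>\<^bsub>W\<^esub> h x"
  using assms by (auto simp: linear_iso_def iso_def hom_def)

text \<open>
  The composite of the inverse of one isomorphism with the other one, as a family of injective
  linear maps commuting with the transition maps.
\<close>

lemma pmodule_iso_transfer:
  assumes P: "pmodule_closed P" and PD: "pmodule_isomorphic P D" and PD': "pmodule_isomorphic P D'"
  obtains g where
    "\<And>t. inj_on (g t) (carrier (fst D t))"
    "\<And>t x. x \<in> carrier (fst D t) \<Longrightarrow> g t x \<in> carrier (fst D' t)"
    "\<And>t x y. x \<in> carrier (fst D t) \<Longrightarrow> y \<in> carrier (fst D t) \<Longrightarrow>
       g t (x \<oplus>\<^bsub>fst D t\<^esub> y) = g t x \<oplus>\<^bsub>fst D' t\<^esub> g t y"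
    "\<And>t a x. x \<in> carrier (fst D t) \<Longrightarrow> g t (a \<odot>\<^bsub>fst D t\<^esub> x) = a \<odot>\<^bsub>fst D' t\<^esub> g t x"
    "\<And>s t x. s \<le> t \<Longrightarrow> x \<in> carrier (fst D s) \<Longrightarrow> g t (snd D s t x) = snd D' s t (g s x)"
proof -
  obtain h where h: "\<And>t. h t \<in> linear_iso (fst P t) (fst D t)"
    "\<And>s t x. s \<le> t \<Longrightarrow> x \<in> carrier (fst P s) \<Longrightarrow> h t (snd P s t x) = snd D s t (h s x)"
    using PD unfolding pmodule_isomorphic_def by blast
  obtain h' where h': "\<And>t. h' t \<in> linear_iso (fst P t) (fst D' t)"
    "\<And>s t x. s \<le> t \<Longrightarrow> x \<in> carrier (fst P s) \<Longrightarrow> h' t (snd P s t x) = snd D' s t (h' s x)"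
    using PD' unfolding pmodule_isomorphic_def by blast
  note hD = linear_isoD[OF h(1)] and hD' = linear_isoD[OF h'(1)]
  define k where "k t = inv_into (carrier (fst P t)) (h t)" for t
  have kin: "k t x \<in> carrier (fst P t)" and hk: "h t (k t x) = x" if "x \<in> carrier (fst D t)" for t x
    using hD(1)[of t] that unfolding k_def bij_betw_def by (auto intro: inv_into_into f_inv_into_f)
  have kh: "k t (h t u) = u" if "u \<in> carrier (fst P t)" for t u
    using hD(1)[of t] that unfolding k_def bij_betw_def by simp
  have cl: "x \<oplus>\<^bsub>fst P t\<^esub> y \<in> carrier (fst P t)" "a \<odot>\<^bsub>fst P t\<^esub> x \<in> carrier (fst P t)"
    if "x \<in> carrier (fst P t)" "y \<in> carrier (fst P t)" for t x y a
    using P that by (auto simp: pmodule_closed_def)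
  have cl': "snd P s t x \<in> carrier (fst P t)" if "s \<le> t" "x \<in> carrier (fst P s)" for s t x
    using P that by (auto simp: pmodule_closed_def)
  show ?thesis
  proof (rule that[of "\<lambda>t x. h' t (k t x)"])
    show "inj_on (\<lambda>x. h' t (k t x)) (carrier (fst D t))" for t
    proof (rule inj_onI)
      fix x y assume xy: "x \<in> carrier (fst D t)" "y \<in> carrier (fst D t)" "h' t (k t x) = h' t (k t y)"
      then have "k t x = k t y" using hD'(1)[of t] kin by (auto simp: bij_betw_def dest: inj_onD)
      then show "x = y" using hk xy by metis
    qed
    show "h' t (k t x) \<in> carrier (fst D' t)" if "x \<in> carrier (fst D t)" for t x
      using hD'(1)[of t] kin[OF that] by (auto simp: bij_betw_def)
    show "h' t (k t (x \<oplus>\<^bsub>fst D t\<^esub> y)) = h' t (k t x) \<oplus>\<^bsub>fst D' t\<^esub> h' t (k t y)"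
      if xy: "x \<in> carrier (fst D t)" "y \<in> carrier (fst D t)" for t x y
    proof -
      note kk = kin[OF xy(1)] kin[OF xy(2)]
      have "k t (x \<oplus>\<^bsub>fst D t\<^esub> y) = k t (h t (k t x \<oplus>\<^bsub>fst P t\<^esub> k t y))"
        using hD(2)[OF kk] hk xy by simp
      then show ?thesis using kh[OF cl(1)[OF kk]] hD'(2)[OF kk] by simp
    qed
    show "h' t (k t (a \<odot>\<^bsub>fst D t\<^esub> x)) = a \<odot>\<^bsub>fst D' t\<^esub> h' t (k t x)"
      if x: "x \<in> carrier (fst D t)" for t a x
    proof -
      note kk = kin[OF x]
      have "k t (a \<odot>\<^bsub>fst D t\<^esub> x) = k t (h t (a \<odot>\<^bsub>fst P t\<^esub> k t x))"
        using hD(3)[OF kk] hk x by simp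
      then show ?thesis using kh[OF cl(2)[OF kk kk]] hD'(3)[OF kk] by simp
    qed
    show "h' t (k t (snd D s t x)) = snd D' s t (h' s (k s x))"
      if st: "s \<le> t" and x: "x \<in> carrier (fst D s)" for s t x
    proof -
      note kk = kin[OF x]
      have "k t (snd D s t x) = k t (h t (snd P s t (k s x)))"
        using h(2)[OF st kk] hk x by simp
      then show ?thesis using kh[OF cl'[OF st kk]] h'(2)[OF st kk] by simp
    qed
  qed
qed

abbreviation interval_sum :: "nat \<Rightarrow> (nat \<Rightarrow> real set) \<Rightarrow> ('k::field, nat \<Rightarrow> 'k) pmodule" where
  "interval_sum N J \<equiv> direct_sum {..<N} (\<lambda>i. interval_module (J i))"

lemma interval_sum_simps:
  fixes N J defines "D \<equiv> interval_sum N J :: ('k::field, nat \<Rightarrow> 'k) pmodule"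
  shows "carrier (fst D t) = (\<Pi>\<^sub>E i\<in>{..<N}. if t \<in> J i then UNIV else {0})"
    and "x \<oplus>\<^bsub>fst D t\<^esub> y = (\<lambda>i\<in>{..<N}. x i + y i)"
    and "a \<odot>\<^bsub>fst D t\<^esub> x = (\<lambda>i\<in>{..<N}. a * x i)"
    and "snd D s t x = (\<lambda>i\<in>{..<N}. if s \<in> J i \<and> t \<in> J i then x i else 0)"
  by (simp_all add: D_def direct_sum_def interval_module_def)

text \<open>
  The vectors supported in the intervals containing both \<open>s\<close> and \<open>t\<close> are unchanged by the transition
  map of the first sum, so naturality forces their images into the image of the transition map of
  the second sum; comparing dimensions gives the inequality, and symmetry the invariance of the rank.
\<close>

lemma rank_at_le:
  fixes P :: "('k::field, 'a) pmodule"
  assumes P: "pmodule_closed P" "pmodule_isomorphic P (interval_sum N J)"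
      "pmodule_isomorphic P (interval_sum N' J')"
    and st: "s \<le> t"
  shows "rank_at N J s t \<le> rank_at N' J' s t"
proof -
  obtain g where raw: "\<And>t. inj_on (g t) (carrier (fst (interval_sum N J) t))"
    "\<And>t x. x \<in> carrier (fst (interval_sum N J) t) \<Longrightarrow> g t x \<in> carrier (fst (interval_sum N' J') t)"
    "\<And>t x y. x \<in> carrier (fst (interval_sum N J) t) \<Longrightarrow> y \<in> carrier (fst (interval_sum N J) t) \<Longrightarrow>
       g t (x \<oplus>\<^bsub>fst (interval_sum N J) t\<^esub> y) = g t x \<oplus>\<^bsub>fst (interval_sum N' J') t\<^esub> g t y"
    "\<And>t a x. x \<in> carrier (fst (interval_sum N J) t) \<Longrightarrow>
       g t (a \<odot>\<^bsub>fst (interval_sum N J) t\<^esub> x) = a \<odot>\<^bsub>fst (interval_sum N' J') t\<^esub> (g t x :: nat \<Rightarrow> 'k)"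
    "\<And>s t x. s \<le> t \<Longrightarrow> x \<in> carrier (fst (interval_sum N J) s) \<Longrightarrow>
       g t (snd (interval_sum N J) s t x) = snd (interval_sum N' J') s t (g s x)"
    using pmodule_iso_transfer[OF P] by blast
  note g = raw(1,2) raw(3-5)[unfolded interval_sum_simps(2-4)]
  define S where "S = {i. i < N \<and> s \<in> J i \<and> t \<in> J i}"
  define S' where "S' = {i. i < N' \<and> s \<in> J' i \<and> t \<in> J' i}"
  \<comment> \<open>\<open>r\<close> cuts a function down to \<open>S\<close>, where it is a vector at both \<open>s\<close> and \<open>t\<close>; \<open>G\<close> is \<open>g t\<close> made total.\<close>
  define r :: "(nat \<Rightarrow> 'k) \<Rightarrow> nat \<Rightarrow> 'k" where "r x = (\<lambda>i\<in>{..<N}. if i \<in> S then x i else 0)" for x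
  define G where "G x = (\<lambda>k. if k < N' then g t (r x) k else 0)" for x
  have r: "r x \<in> carrier (fst (interval_sum N J) u)" if "u \<in> {s, t}" for x u
    using that by (auto simp: interval_sum_simps r_def S_def)
  have "card S \<le> card S'"
  proof (rule card_le_if_linear_injective[where G = G])
    show "finite S" "finite S'" by (auto simp: S_def S'_def)
    show "G (x + y) = G x + G y" for x y
    proof -
      have "r (x + y) = (\<lambda>i\<in>{..<N}. r x i + r y i)" by (auto simp: r_def)
      then show ?thesis using g(3)[of "r x" t "r y"] r by (auto simp: G_def)
    qed
    show "G (scale_fun a x) = scale_fun a (G x)" for a x
    proof -
      have "r (scale_fun a x) = (\<lambda>i\<in>{..<N}. a * r x i)" by (auto simp: r_def scale_fun_def)
      then show ?thesis using g(4)[of "r x" t a] r by (auto simp: G_def scale_fun_def)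
    qed
    show "inj_on G {x. \<forall>i. i \<notin> S \<longrightarrow> x i = 0}"
    proof (rule inj_onI, clarsimp)
      fix x y :: "nat \<Rightarrow> 'k"
      assume x: "\<forall>i. i \<notin> S \<longrightarrow> x i = 0" and y: "\<forall>i. i \<notin> S \<longrightarrow> y i = 0" and eq: "G x = G y"
      have "g t (r x) = g t (r y)"
      proof (rule PiE_ext)
        show "g t (r x) \<in> (\<Pi>\<^sub>E i\<in>{..<N'}. if t \<in> J' i then UNIV else {0})"
          "g t (r y) \<in> (\<Pi>\<^sub>E i\<in>{..<N'}. if t \<in> J' i then UNIV else {0})"
          using g(2)[OF r, of t] by (auto simp: interval_sum_simps)
        show "g t (r x) k = g t (r y) k" if "k \<in> {..<N'}" for k
          using fun_cong[OF eq, of k] that by (simp add: G_def)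
      qed
      then have rxy: "r x = r y" using g(1)[of t] r by (auto dest: inj_onD)
      have "x i = y i" if "i \<in> S" for i
        using that fun_cong[OF rxy, of i] by (simp add: r_def S_def)
      then show "x = y" using x y by (metis ext)
    qed
    show "G x k = 0" if "k \<notin> S'" for x k
    proof -
      have "r x = (\<lambda>i\<in>{..<N}. if s \<in> J i \<and> t \<in> J i then r x i else 0)"
        by (auto simp: r_def S_def)
      then have "g t (r x) = (\<lambda>i\<in>{..<N'}. if s \<in> J' i \<and> t \<in> J' i then g s (r x) i else 0)"
        using g(5)[OF st r, of x] by simp
      then show ?thesis using that by (auto simp: G_def S'_def)
    qed
  qed
  then show ?thesis by (simp add: rank_at_def S_def S'_def)
qed

section \<open>Cycles, boundaries and homology classes\<close>

text \<open>
  Chains are added and scaled pointwise; these equations fold the pointwise operations into those of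
  the vector space \<^const>\<open>scale_fun\<close>.
\<close>

lemma plus_scale_eta:
  "(\<lambda>\<sigma>. c \<sigma> + d \<sigma>) = c + d" "(\<lambda>\<sigma>. a * c \<sigma>) = scale_fun a c" "(\<lambda>_. 0) = (0 :: 'a \<Rightarrow> 'k)"
  for c d :: "'a \<Rightarrow> 'k::field"
  by (auto simp: scale_fun_def)

lemma boundary_add: "boundary L (c + d) = boundary L c + boundary L d"
  by (auto simp: boundary_def fun_eq_iff algebra_simps sum.distrib)

lemma boundary_scale: "boundary L (scale_fun a c) = scale_fun a (boundary L c)"
  by (auto simp: boundary_def scale_fun_def fun_eq_iff sum_distrib_left mult.left_commute)

lemma boundary_eq_on_chains:
  assumes "c \<in> chains L p" "L \<subseteq> L'" "finite L'"
  shows "boundary L' c = boundary L c"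
proof
  fix \<tau>
  have "c \<sigma> = 0" if "\<sigma> \<notin> L" for \<sigma> using assms(1) that by (auto simp: chains_def)
  then show "boundary L' c \<tau> = boundary L c \<tau>"
    unfolding boundary_def using assms(2,3) by (auto intro!: sum.mono_neutral_right)
qed

lemma subspace_chains: "fun_space.subspace (chains L p)"
  by (auto simp: fun_space.subspace_def chains_def scale_fun_def) (metis add.left_neutral)+

lemma chains_mono: "L \<subseteq> L' \<Longrightarrow> chains L p \<subseteq> chains L' p"
  by (auto simp: chains_def)

lemma subspace_cycles: "fun_space.subspace (cycles L p)"
proof -
  have "boundary L (0 :: _ \<Rightarrow> 'k::field) = 0" by (auto simp: boundary_def)
  then show ?thesis using subspace_chains[of L p]
    by (auto simp: fun_space.subspace_def cycles_def plus_scale_eta boundary_add boundary_scale)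
qed

lemma subspace_boundaries:
  "fun_space.subspace (boundaries L p :: ('v::linorder set \<Rightarrow> 'k::field) set)"
proof (rule fun_space.subspaceI)
  note sub = subspace_chains[of L "p + 1"]
  have "boundary L (0 :: _ \<Rightarrow> 'k::field) = 0" by (auto simp: boundary_def)
  then show "(0 :: _ \<Rightarrow> 'k) \<in> boundaries L p"
    unfolding boundaries_def using fun_space.subspace_0[OF sub] by (intro image_eqI[of _ _ 0]) simp_all
  fix x y :: "_ \<Rightarrow> 'k" and a :: 'k assume "x \<in> boundaries L p"
  then obtain c where c: "c \<in> chains L (p + 1)" "x = boundary L c" by (auto simp: boundaries_def)
  show "scale_fun a x \<in> boundaries L p"
    unfolding boundaries_def c(2) boundary_scale[symmetric]
    using fun_space.subspace_scale[OF sub c(1)] by (rule imageI)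
  assume "y \<in> boundaries L p"
  then obtain d where d: "d \<in> chains L (p + 1)" "y = boundary L d" by (auto simp: boundaries_def)
  show "x + y \<in> boundaries L p"
    unfolding boundaries_def c(2) d(2) boundary_add[symmetric]
    using fun_space.subspace_add[OF sub c(1) d(1)] by (rule imageI)
qed

lemma cycles_mono: "L \<subseteq> L' \<Longrightarrow> finite L' \<Longrightarrow> cycles L p \<subseteq> cycles L' p"
  using chains_mono[of L L' p] by (auto simp: cycles_def boundary_eq_on_chains)

lemma boundaries_mono:
  assumes L: "L \<subseteq> L'" "finite L'"
  shows "boundaries L p \<subseteq> boundaries L' p"
proof
  fix x assume "x \<in> boundaries L p"
  then obtain c where c: "c \<in> chains L (p + 1)" "x = boundary L c" by (auto simp: boundaries_def)
  then have "x = boundary L' c" using boundary_eq_on_chains[OF c(1) L] by simp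
  then show "x \<in> boundaries L' p"
    unfolding boundaries_def using c(1) chains_mono[OF L(1)] by blast
qed

lemma chains_empty: "chains {} p = {0}"
  by (auto simp: chains_def fun_eq_iff)

lemma cycles_empty: "cycles {} p = {0 :: 'v::linorder set \<Rightarrow> 'k::field}"
  and boundaries_empty: "boundaries {} p = {0 :: 'v::linorder set \<Rightarrow> 'k::field}"
proof -
  have "boundary {} 0 = (0 :: _ \<Rightarrow> 'k::field)" by (auto simp: boundary_def)
  then show "cycles {} p = {0 :: _ \<Rightarrow> 'k}" "boundaries {} p = {0 :: _ \<Rightarrow> 'k}"
    unfolding cycles_def boundaries_def chains_empty by (auto simp: zero_fun_def)
qed

lemma cycles_subset_span_unit_fun: "finite L \<Longrightarrow> cycles L p \<subseteq> fun_space.span (unit_fun ` L)"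
  by (auto simp: span_unit_fun cycles_def chains_def)

definition homology_class :: "'v::linorder set set \<Rightarrow> nat \<Rightarrow> ('v set \<Rightarrow> 'k::field) \<Rightarrow> ('v set \<Rightarrow> 'k) set" where
  "homology_class L p z = {b + z | b. b \<in> boundaries L p}"

lemma cycle_module_simps:
  "carrier (cycle_module L p) = cycles L p"
  "x \<oplus>\<^bsub>cycle_module L p\<^esub> y = x + y"
  "a \<odot>\<^bsub>cycle_module L p\<^esub> x = scale_fun a x"
  by (auto simp: cycle_module_def scale_fun_def fun_eq_iff)

lemma coset_eq_homology_class:
  "boundaries L p +>\<^bsub>cycle_module L p\<^esub> z = homology_class L p z"
  unfolding a_r_coset_def' cycle_module_simps homology_class_def by blast

lemma self_in_homology_class: "z \<in> homology_class L p z"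
  using fun_space.subspace_0[OF subspace_boundaries] by (force simp: homology_class_def)

lemma homology_class_eq_iff:
  "homology_class L p z = homology_class L p w \<longleftrightarrow> z - w \<in> boundaries L p"
proof
  assume "homology_class L p z = homology_class L p w"
  then have "z \<in> homology_class L p w" using self_in_homology_class by metis
  then show "z - w \<in> boundaries L p" by (auto simp: homology_class_def)
next
  assume zw: "z - w \<in> boundaries L p"
  note sub = subspace_boundaries[of L p]
  have "b + z = (b + (z - w)) + w" "b + w = (b - (z - w)) + z" for b by auto
  then show "homology_class L p z = homology_class L p w"
    unfolding homology_class_def
    using fun_space.subspace_add[OF sub _ zw] fun_space.subspace_diff[OF sub _ zw] by blast
qed

lemma homology_class_cong: "w \<in> homology_class L p z \<Longrightarrow> homology_class L p w = homology_class L p z"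
  by (auto simp: homology_class_eq_iff) (auto simp: homology_class_def)

lemma carrier_homology: "carrier (homology L p) = homology_class L p ` cycles L p"
proof -
  have "carrier (homology L p)
    = (\<Union>z\<in>cycles L p. {boundaries L p +>\<^bsub>cycle_module L p\<^esub> z})"
    by (simp add: homology_def quotient_module_def A_RCOSETS_def' a_r_coset_def' cycle_module_simps)
  then show ?thesis unfolding coset_eq_homology_class by blast
qed

lemma homology_class_add:
  "homology_class L p z \<oplus>\<^bsub>homology L p\<^esub> homology_class L p w = homology_class L p (z + w)"
proof -
  note sub = subspace_boundaries[of L p]
  have "homology_class L p z \<oplus>\<^bsub>homology L p\<^esub> homology_class L p w
    = (\<Union>x\<in>homology_class L p z. \<Union>y\<in>homology_class L p w. {x + y})"
    by (simp add: homology_def quotient_module_def set_add_def' cycle_module_simps)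
  also have "\<dots> = homology_class L p (z + w)"
  proof (intro equalityI subsetI)
    fix u assume "u \<in> (\<Union>x\<in>homology_class L p z. \<Union>y\<in>homology_class L p w. {x + y})"
    then obtain b c where bc: "b \<in> boundaries L p" "c \<in> boundaries L p" "u = (b + z) + (c + w)"
      by (auto simp: homology_class_def)
    then have "u = (b + c) + (z + w)" by (simp add: add_ac)
    then show "u \<in> homology_class L p (z + w)"
      unfolding homology_class_def using fun_space.subspace_add[OF sub bc(1,2)] by blast
  next
    fix u assume "u \<in> homology_class L p (z + w)"
    then obtain b where b: "b \<in> boundaries L p" "u = (b + z) + w"
      by (auto simp: homology_class_def add_ac)
    then have "b + z \<in> homology_class L p z" unfolding homology_class_def by blast
    then show "u \<in> (\<Union>x\<in>homology_class L p z. \<Union>y\<in>homology_class L p w. {x + y})"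
      using b(2) self_in_homology_class[of w L p] by blast
  qed
  finally show ?thesis .
qed

lemma homology_class_scale:
  "a \<odot>\<^bsub>homology L p\<^esub> homology_class L p z = homology_class L p (scale_fun a z)"
proof -
  have "homology_class L p (scale_fun a x) = homology_class L p (scale_fun a z)"
    if "x \<in> homology_class L p z" for x
  proof -
    have "x - z \<in> boundaries L p" using that by (auto simp: homology_class_def)
    from fun_space.subspace_scale[OF subspace_boundaries this, of a] show ?thesis
      by (simp add: homology_class_eq_iff fun_space.scale_right_diff_distrib)
  qed
  then have "(\<Union>x\<in>homology_class L p z. homology_class L p (scale_fun a x))
    = (\<Union>x\<in>homology_class L p z. homology_class L p (scale_fun a z))"
    by (intro SUP_cong refl)
  also have "\<dots> = homology_class L p (scale_fun a z)"
    using self_in_homology_class[of z L p] by blast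
  finally show ?thesis
    by (simp add: homology_def quotient_module_def coset_eq_homology_class cycle_module_simps)
qed

lemma homology_map_class:
  assumes "L \<subseteq> L'" "finite L'"
  shows "homology_map L' p (homology_class L p z) = homology_class L' p z"
proof -
  have "homology_class L' p x = homology_class L' p z" if "x \<in> homology_class L p z" for x
    using that boundaries_mono[OF assms, of p]
    by (intro homology_class_cong) (auto simp: homology_class_def)
  then have "(\<Union>x\<in>homology_class L p z. homology_class L' p x)
    = (\<Union>x\<in>homology_class L p z. homology_class L' p z)"
    by (intro SUP_cong refl)
  also have "\<dots> = homology_class L' p z" using self_in_homology_class[of z L p] by blast
  finally show ?thesis by (simp add: homology_map_def coset_eq_homology_class)
qed

section \<open>Interval decomposition from an adapted basis\<close>

definition filtered_homology ::
  "(real \<Rightarrow> 'v::linorder set set) \<Rightarrow> nat \<Rightarrow> ('k::field, ('v set \<Rightarrow> 'k) set) pmodule" where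
  "filtered_homology L p = ((\<lambda>t. homology (L t) p), (\<lambda>s t. homology_map (L t) p))"

lemma pmodule_closed_filtered_homology:
  assumes "mono L" "\<And>t. finite (L t)"
  shows "pmodule_closed (filtered_homology L p)"
proof -
  have "homology_map (L t) p (homology_class (L s) p z) \<in> homology_class (L t) p ` cycles (L t) p"
    if "s \<le> t" "z \<in> cycles (L s) p" for s t z
  proof -
    note sub = monoD[OF assms(1) that(1)] assms(2)[of t]
    show ?thesis using cycles_mono[OF sub, of p] that(2) by (auto simp: homology_map_class[OF sub])
  qed
  moreover have "homology_class (L t) p (x + y) \<in> homology_class (L t) p ` cycles (L t) p"
    "homology_class (L t) p (scale_fun a x) \<in> homology_class (L t) p ` cycles (L t) p"
    if "x \<in> cycles (L t) p" "y \<in> cycles (L t) p" for x y a t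
    using fun_space.subspace_add[OF subspace_cycles that]
      fun_space.subspace_scale[OF subspace_cycles that(1)] by blast+
  ultimately show ?thesis
    by (auto simp: pmodule_closed_def filtered_homology_def carrier_homology homology_class_add
        homology_class_scale)
qed

text \<open>
  The isomorphism sends the class of a cycle to its coefficients at the basis vectors alive at \<open>t\<close>,
  that is, those in \<open>Z\<^sub>t\<close> but not in \<open>B\<^sub>t\<close>. It is well defined and injective because a cycle is a boundary
  exactly when all these coefficients vanish. It is natural because a basis vector that is alive at \<open>t\<close>
  but not at \<open>s \<le> t\<close> is not yet a cycle at \<open>s\<close>: it does not occur in the cycles at \<open>s\<close>.
\<close>

lemma interval_decomposition_of_adapted_basis:
  fixes L :: "real \<Rightarrow> 'v::linorder set set" and E :: "('v set \<Rightarrow> 'k::field) set"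
  assumes L: "mono L" "\<And>t. finite (L t)"
    and E: "fun_space.independent E"
      "\<And>t. cycles (L t) p \<subseteq> fun_space.span (E \<inter> cycles (L t) p)"
      "\<And>t. boundaries (L t) p \<subseteq> fun_space.span (E \<inter> boundaries (L t) p)"
    and e: "inj_on e {..<N}" "e ` {..<N} \<subseteq> E"
      "\<And>x t. x \<in> E \<Longrightarrow> x \<in> cycles (L t) p \<Longrightarrow> x \<notin> boundaries (L t) p \<Longrightarrow> x \<in> e ` {..<N}"
    and J: "\<And>i t. i < N \<Longrightarrow> t \<in> J i \<longleftrightarrow> e i \<in> cycles (L t) p \<and> e i \<notin> boundaries (L t) p"
  shows "pmodule_isomorphic (filtered_homology L p :: ('k, ('v set \<Rightarrow> 'k) set) pmodule) (interval_sum N J)"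
proof -
  let ?rep = "fun_space.representation E"
  define coeff where "coeff t z = (\<lambda>i\<in>{..<N}. if t \<in> J i then ?rep z (e i) else 0)" for t z
  \<comment> \<open>A class is evaluated at an arbitrary representative.\<close>
  define h where "h t X = coeff t (SOME z. z \<in> X)" for t X
  have cyc: "cycles (L t) p \<subseteq> fun_space.span E" for t
    using E(2)[of t] fun_space.span_mono[of "E \<inter> cycles (L t) p" E] by blast
  have bd: "boundaries (L t) p \<subseteq> fun_space.span E" for t
    using E(3)[of t] fun_space.span_mono[of "E \<inter> boundaries (L t) p" E] by blast
  note cyc_iff = fun_space.mem_subspace_iff_representation[OF E(1) subspace_cycles E(2)]
  note bd_iff = fun_space.mem_subspace_iff_representation[OF E(1) subspace_boundaries E(3)]
  have h: "h t (homology_class (L t) p z) = coeff t z" if z: "z \<in> cycles (L t) p" for t z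
  proof -
    define w where "w = (SOME w. w \<in> homology_class (L t) p z)"
    have "w \<in> homology_class (L t) p z"
      unfolding w_def by (rule someI[of "\<lambda>w. w \<in> homology_class (L t) p z"]) (rule self_in_homology_class)
    then obtain b where b: "b \<in> boundaries (L t) p" "w = b + z" by (auto simp: homology_class_def)
    have "?rep w (e i) = ?rep z (e i)" if i: "i < N" "t \<in> J i" for i
    proof -
      have "?rep b (e i) = 0" using bd_iff[of b t] b(1) bd[of t] J i by blast
      moreover have "?rep (b + z) = (\<lambda>x. ?rep b x + ?rep z x)"
        using b(1) bd[of t] cyc[of t] z by (intro fun_space.representation_add[OF E(1)]) blast+
      ultimately show ?thesis using b(2) by simp
    qed
    then show ?thesis by (auto simp: h_def coeff_def w_def[symmetric])
  qed
  have "h t \<in> linear_iso (homology (L t) p) (fst (interval_sum N J) t)" for t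
  proof -
    have maps: "coeff t z \<in> carrier (fst (interval_sum N J) t)" for z
      by (auto simp: interval_sum_simps coeff_def)
    have add: "coeff t (z + w) = coeff t z \<oplus>\<^bsub>fst (interval_sum N J) t\<^esub> coeff t w"
      if "z \<in> cycles (L t) p" "w \<in> cycles (L t) p" for z w
    proof -
      have "?rep (z + w) = (\<lambda>x. ?rep z x + ?rep w x)"
        using that cyc[of t] by (intro fun_space.representation_add[OF E(1)]) blast+
      then show ?thesis by (auto simp: interval_sum_simps coeff_def)
    qed
    have scale: "coeff t (scale_fun a z) = a \<odot>\<^bsub>fst (interval_sum N J) t\<^esub> coeff t z"
      if "z \<in> cycles (L t) p" for a z
    proof -
      have "?rep (scale_fun a z) = (\<lambda>x. a * ?rep z x)"
        using that cyc[of t] by (intro fun_space.representation_scale[OF E(1)]) blast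
      then show ?thesis by (auto simp: interval_sum_simps coeff_def)
    qed
    have inj: "z - w \<in> boundaries (L t) p"
      if zw: "z \<in> cycles (L t) p" "w \<in> cycles (L t) p" "coeff t z = coeff t w" for z w
    proof -
      have d: "z - w \<in> cycles (L t) p" using zw(1,2) fun_space.subspace_diff[OF subspace_cycles] by blast
      then have d': "z - w \<in> fun_space.span E" using cyc by blast
      have "x \<in> boundaries (L t) p" if x: "?rep (z - w) x \<noteq> 0" for x
      proof (rule ccontr)
        assume "x \<notin> boundaries (L t) p"
        moreover have "x \<in> cycles (L t) p" using cyc_iff[OF d'] d x by blast
        moreover have "x \<in> E" using x by (rule fun_space.representation_ne_zero)
        ultimately obtain i where i: "i < N" "x = e i" "t \<in> J i" using e(3)[of x t] J by auto
        have "?rep (z - w) = (\<lambda>x. ?rep z x - ?rep w x)"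
          using zw(1,2) cyc[of t] by (intro fun_space.representation_diff[OF E(1)]) blast+
        then have "?rep (z - w) x = 0" using fun_cong[OF zw(3), of i] i by (auto simp: coeff_def)
        then show False using x by simp
      qed
      then show ?thesis using bd_iff[OF d'] by blast
    qed
    have surj: "\<exists>z\<in>cycles (L t) p. coeff t z = y" if y: "y \<in> carrier (fst (interval_sum N J) t)" for y
    proof -
      define z where "z = (\<Sum>i | i < N \<and> t \<in> J i. scale_fun (y i) (e i))"
      have z: "z \<in> cycles (L t) p"
        unfolding z_def using J
        by (intro fun_space.subspace_sum[OF subspace_cycles] fun_space.subspace_scale[OF subspace_cycles]) auto
      have "?rep z (e j) = y j" if j: "j < N" "t \<in> J j" for j
      proof -
        have "?rep z (e j) = (\<Sum>i | i < N \<and> t \<in> J i. ?rep (scale_fun (y i) (e i)) (e j))"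
          unfolding z_def using e(2)
          by (subst fun_space.representation_sum[OF E(1)])
            (auto intro: fun_space.span_base fun_space.span_scale simp: sum_fun_apply)
        also have "\<dots> = (\<Sum>i | i < N \<and> t \<in> J i. if i = j then y i else 0)"
        proof (intro sum.cong refl)
          fix i assume i: "i \<in> {i. i < N \<and> t \<in> J i}"
          then have ei: "e i \<in> E" using e(2) by auto
          have "e i = e j \<longleftrightarrow> i = j" using e(1) i j(1) by (auto dest: inj_onD)
          then show "?rep (scale_fun (y i) (e i)) (e j) = (if i = j then y i else 0)"
            using fun_space.representation_scale[OF E(1) fun_space.span_base[OF ei], of "y i"]
              fun_space.representation_basis[OF E(1) ei] by auto
        qed
        also have "\<dots> = y j" using j by (simp add: sum.delta)
        finally show ?thesis .
      qed
      moreover have "y j = 0" if "j < N" "t \<notin> J j" for j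
        using PiE_mem[OF y[unfolded interval_sum_simps], of j] that by simp
      ultimately have "coeff t z = y"
        using y by (auto simp: coeff_def interval_sum_simps PiE_iff extensional_def fun_eq_iff)
      then show ?thesis using z by blast
    qed
    have "bij_betw (h t) (carrier (homology (L t) p)) (carrier (fst (interval_sum N J) t))"
      unfolding bij_betw_def
    proof
      show "inj_on (h t) (carrier (homology (L t) p))"
      proof (rule inj_onI)
        fix X Y assume XY: "X \<in> carrier (homology (L t) p)" "Y \<in> carrier (homology (L t) p)" "h t X = h t Y"
        then obtain z w where "z \<in> cycles (L t) p" "w \<in> cycles (L t) p"
          "X = homology_class (L t) p z" "Y = homology_class (L t) p w"
          unfolding carrier_homology by blast
        then show "X = Y" using inj[of z w] XY(3) by (simp add: h homology_class_eq_iff)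
      qed
      show "h t ` carrier (homology (L t) p) = carrier (fst (interval_sum N J) t)"
        unfolding carrier_homology image_image using surj maps by (fastforce simp: h)
    qed
    moreover have "h t (X \<oplus>\<^bsub>homology (L t) p\<^esub> Y) = h t X \<oplus>\<^bsub>fst (interval_sum N J) t\<^esub> h t Y"
      if XY: "X \<in> carrier (homology (L t) p)" "Y \<in> carrier (homology (L t) p)" for X Y
    proof -
      obtain z w where zw: "z \<in> cycles (L t) p" "w \<in> cycles (L t) p"
        "X = homology_class (L t) p z" "Y = homology_class (L t) p w"
        using XY unfolding carrier_homology by blast
      then show ?thesis using fun_space.subspace_add[OF subspace_cycles zw(1,2)] add[OF zw(1,2)]
        by (simp add: homology_class_add h)
    qed
    moreover have "h t (a \<odot>\<^bsub>homology (L t) p\<^esub> X) = a \<odot>\<^bsub>fst (interval_sum N J) t\<^esub> h t X"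
      if X: "X \<in> carrier (homology (L t) p)" for a X
    proof -
      obtain z where z: "z \<in> cycles (L t) p" "X = homology_class (L t) p z"
        using X unfolding carrier_homology by blast
      then show ?thesis using fun_space.subspace_scale[OF subspace_cycles z(1), of a] scale[OF z(1)]
        by (simp add: homology_class_scale h)
    qed
    ultimately show ?thesis
      by (auto simp: linear_iso_def iso_def hom_def bij_betw_def)
  qed
  moreover have "h t (homology_map (L t) p X) = snd (interval_sum N J) s t (h s X)"
    if st: "s \<le> t" and X: "X \<in> carrier (homology (L s) p)" for s t X
  proof -
    obtain z where z: "z \<in> cycles (L s) p" "X = homology_class (L s) p z"
      using X by (auto simp: carrier_homology)
    note sub = monoD[OF L(1) st] L(2)[of t]
    have z': "z \<in> cycles (L t) p" using z(1) cycles_mono[OF sub] by blast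
    have "?rep z (e i) = 0" if "i < N" "t \<in> J i" "s \<notin> J i" for i
    proof -
      have "e i \<notin> cycles (L s) p" using J that boundaries_mono[OF sub] by blast
      then show ?thesis using cyc_iff[of z s] z(1) cyc by blast
    qed
    then show ?thesis
      using z z' by (auto simp: h homology_map_class[OF sub] interval_sum_simps coeff_def fun_eq_iff)
  qed
  ultimately show ?thesis
    unfolding pmodule_isomorphic_def filtered_homology_def fst_conv snd_conv by blast
qed

section \<open>The barcode over an ordering class of filter functions\<close>

lemma sublevel_mono: "s \<le> t \<Longrightarrow> sublevel K f s \<subseteq> sublevel K f t"
  by (auto simp: sublevel_def)

lemma finite_sublevel: "finite K \<Longrightarrow> finite (sublevel K f t)"
  by (auto simp: sublevel_def)

lemma ordering_equiv_le: "ordering_equiv K g f \<Longrightarrow> \<sigma> \<in> K \<Longrightarrow> \<tau> \<in> K \<Longrightarrow> g \<sigma> \<le> g \<tau> \<longleftrightarrow> f \<sigma> \<le> f \<tau>"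
  by (auto simp: ordering_equiv_def)

lemma ordering_equiv_refl: "ordering_equiv K f f"
  by (simp add: ordering_equiv_def)

lemma sublevel_at_value:
  assumes "ordering_equiv K g f" "\<sigma> \<in> K"
  shows "sublevel K g (g \<sigma>) = sublevel K f (f \<sigma>)"
  using ordering_equiv_le[OF assms(1) _ assms(2)] by (auto simp: sublevel_def)

text \<open>
  The sublevel complexes of equivalent functions are the same subcomplexes, only reached at other
  parameters.
\<close>

lemma sublevel_cases:
  assumes K: "finite K" and gf: "ordering_equiv K g f"
  obtains "sublevel K g t = {}"
  | \<sigma> where "\<sigma> \<in> K" "g \<sigma> \<le> t" "sublevel K g t = sublevel K f (f \<sigma>)"
proof (cases "sublevel K g t = {}")
  case False
  obtain \<sigma> where \<sigma>: "\<sigma> \<in> sublevel K g t" "\<And>\<tau>. \<tau> \<in> sublevel K g t \<Longrightarrow> g \<tau> \<le> g \<sigma>"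
    using obtains_MAX[OF finite_sublevel[OF K] False, of g] finite_sublevel[OF K, of g t]
    by (metis Max_ge finite_imageI imageI)
  then have "sublevel K g t = sublevel K g (g \<sigma>)" by (force simp: sublevel_def)
  then show ?thesis using that(2) \<sigma>(1) sublevel_at_value[OF gf, of \<sigma>] by (auto simp: sublevel_def)
qed (rule that(1))

text \<open>
  Applied to cycle and to boundary spaces: a vector enters a monotone family of spaces together with a
  simplex \<open>\<sigma>\<close>, the same one for the whole ordering class, namely one with least value among those at
  whose level the vector is present.
\<close>

lemma entry_time:
  fixes A :: "'v set set \<Rightarrow> 'x set"
  assumes K: "finite K" and A: "\<forall>L L'. L \<subseteq> L' \<and> finite L' \<longrightarrow> A L \<subseteq> A L'" and x: "x \<notin> A {}"
  obtains (never) "\<And>g t. ordering_equiv K g f \<Longrightarrow> x \<notin> A (sublevel K g t)"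
  | (enters) \<sigma> where "\<sigma> \<in> K" "\<And>g t. ordering_equiv K g f \<Longrightarrow> x \<in> A (sublevel K g t) \<longleftrightarrow> g \<sigma> \<le> t"
proof -
  define S where "S = {\<sigma> \<in> K. x \<in> A (sublevel K f (f \<sigma>))}"
  have from_S: "\<exists>\<sigma>\<in>S. g \<sigma> \<le> t" if "ordering_equiv K g f" "x \<in> A (sublevel K g t)" for g t
    using sublevel_cases[OF K that(1), of t] that(2) x by (metis (mono_tags, lifting) S_def mem_Collect_eq)
  show ?thesis
  proof (cases "S = {}")
    case True
    then show ?thesis using never from_S by blast
  next
    case False
    have "finite S" using K by (simp add: S_def)
    then obtain \<sigma> where \<sigma>: "\<sigma> \<in> S" "\<And>\<tau>. \<tau> \<in> S \<Longrightarrow> f \<sigma> \<le> f \<tau>"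
      using obtains_MIN[OF _ False, of f] by (metis Min_le finite_imageI imageI)
    have "x \<in> A (sublevel K g t) \<longleftrightarrow> g \<sigma> \<le> t" if gf: "ordering_equiv K g f" for g t
    proof
      assume "x \<in> A (sublevel K g t)"
      then obtain \<tau> where \<tau>: "\<tau> \<in> S" "g \<tau> \<le> t" using from_S[OF gf] by blast
      then have "g \<sigma> \<le> g \<tau>" using \<sigma> ordering_equiv_le[OF gf, of \<sigma> \<tau>] by (simp add: S_def)
      then show "g \<sigma> \<le> t" using \<tau>(2) by simp
    next
      assume "g \<sigma> \<le> t"
      then have "sublevel K f (f \<sigma>) \<subseteq> sublevel K g t"
        using sublevel_mono[of "g \<sigma>" t K g] sublevel_at_value[OF gf, of \<sigma>] \<sigma>(1) by (simp add: S_def)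
      then have "A (sublevel K f (f \<sigma>)) \<subseteq> A (sublevel K g t)" using A finite_sublevel[OF K] by blast
      then show "x \<in> A (sublevel K g t)" using \<sigma>(1) by (auto simp: S_def)
    qed
    then show ?thesis using enters[of \<sigma>] \<sigma>(1) by (simp add: S_def)
  qed
qed

text \<open>
  The sublevel complexes at the values of \<open>f\<close> are all that is to be adapted to: the only other one is
  empty, with zero cycle and boundary spaces, and equivalent functions have the same ones.
\<close>

lemma adapted_basis_of_filtration:
  fixes K :: "'v::linorder set set" and f :: "'v set \<Rightarrow> real"
  assumes K: "finite K"
  obtains E :: "('v set \<Rightarrow> 'k::field) set" where "fun_space.independent E"
    "\<And>g t. ordering_equiv K g f \<Longrightarrow>
       cycles (sublevel K g t) p \<subseteq> fun_space.span (E \<inter> cycles (sublevel K g t) p)"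
    "\<And>g t. ordering_equiv K g f \<Longrightarrow>
       boundaries (sublevel K g t) p \<subseteq> fun_space.span (E \<inter> boundaries (sublevel K g t) p)"
proof -
  define cs where "cs = sorted_list_of_set (f ` K)"
  have cs: "set cs = f ` K" "sorted cs" using K by (auto simp: cs_def)
  define m where "m = length cs"
  \<comment> \<open>Both flags are continued by the whole space above the largest value of \<open>f\<close>.\<close>
  define Z :: "nat \<Rightarrow> ('v set \<Rightarrow> 'k) set"
    where "Z i = (if i < m then cycles (sublevel K f (cs ! i)) p else UNIV)" for i
  define B :: "nat \<Rightarrow> ('v set \<Rightarrow> 'k) set"
    where "B i = (if i < m then boundaries (sublevel K f (cs ! i)) p else UNIV)" for i
  have sub: "sublevel K f (cs ! i) \<subseteq> sublevel K f (cs ! j)" if "i \<le> j" "j < m" for i j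
    using that cs(2) by (intro sublevel_mono sorted_nth_mono) (auto simp: m_def)
  have step: "Z i \<subseteq> Z j \<and> B i \<subseteq> B j" if "i \<le> j" for i j
  proof (cases "j < m")
    case True
    then show ?thesis
      using that cycles_mono[OF sub finite_sublevel[OF K], of i j p]
        boundaries_mono[OF sub finite_sublevel[OF K], of i j p] by (simp add: Z_def B_def)
  qed (simp add: Z_def B_def)
  have Z: "fun_space.subspace (Z i)" and B: "fun_space.subspace (B i)" for i
    by (auto simp: Z_def B_def subspace_cycles subspace_boundaries)
  have mono: "mono Z" "mono B" using step by (auto simp: mono_def)
  have top: "Z m = UNIV" "B m = UNIV" by (auto simp: Z_def B_def)
  obtain E where E: "fun_space.independent E" "\<And>i. i \<le> m \<Longrightarrow> Z i \<subseteq> fun_space.span (E \<inter> Z i)"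
    "\<And>i. i \<le> m \<Longrightarrow> B i \<subseteq> fun_space.span (E \<inter> B i)"
    using fun_space.adapted_basis_of_two_flags[OF Z mono(1) B mono(2) top] by blast
  have adapted: "cycles (sublevel K g t) p \<subseteq> fun_space.span (E \<inter> cycles (sublevel K g t) p) \<and>
    boundaries (sublevel K g t) p \<subseteq> fun_space.span (E \<inter> boundaries (sublevel K g t) p)"
    if "ordering_equiv K g f" for g t
    using K that
  proof (cases rule: sublevel_cases[where t = t])
    case 1
    then show ?thesis by (simp add: cycles_empty boundaries_empty fun_space.span_zero)
  next
    case (2 \<sigma>)
    then obtain i where "i < m" "cs ! i = f \<sigma>" using cs(1) by (metis image_eqI in_set_conv_nth m_def)
    then show ?thesis using E(2,3)[of i] 2 by (simp add: Z_def B_def)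
  qed
  show ?thesis using that[OF E(1)] adapted by blast
qed

lemma lessThan_add_eq: "{..<m + k} = {..<m} \<union> (\<lambda>j. m + j) ` {..<k}" for m k :: nat
proof -
  have "(\<lambda>j. m + j) ` {..<k} = {m..<m + k}"
    by (simp add: image_add_atLeastLessThan lessThan_atLeast0 add.commute)
  then show ?thesis by auto
qed

text \<open>
  The first \<open>m\<close> intervals belong to basis vectors that become boundaries, the remaining \<open>k\<close> to those that
  never do. Vectors that never become cycles, or not before they are boundaries, are never alive and
  are left out; which ones these are depends on the preorder only.
\<close>

lemma interval_decomposition_over_ordering_class:
  fixes K :: "'v::linorder set set" and f :: "'v set \<Rightarrow> real"
  assumes K: "finite K"
  obtains m b d k v where "\<forall>i<m. b i \<in> K \<and> d i \<in> K" "\<forall>j<k. v j \<in> K"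
    "\<forall>g. ordering_equiv K g f \<longrightarrow> (\<forall>i<m. g (b i) < g (d i)) \<and>
      pmodule_isomorphic (persistent_homology K p g :: ('k::field, _) pmodule)
        (interval_sum (m + k) (\<lambda>i. if i < m then {g (b i)..<g (d i)} else {g (v (i - m))..}))"
proof -
  obtain E :: "('v set \<Rightarrow> 'k) set" where E: "fun_space.independent E"
    "\<And>g t. ordering_equiv K g f \<Longrightarrow>
       cycles (sublevel K g t) p \<subseteq> fun_space.span (E \<inter> cycles (sublevel K g t) p)"
    "\<And>g t. ordering_equiv K g f \<Longrightarrow>
       boundaries (sublevel K g t) p \<subseteq> fun_space.span (E \<inter> boundaries (sublevel K g t) p)"
    using adapted_basis_of_filtration[OF K] by blast
  define live where "live g t x \<longleftrightarrow> x \<in> cycles (sublevel K g t) p \<and> x \<notin> boundaries (sublevel K g t) p"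
    for g t and x :: "'v set \<Rightarrow> 'k"
  \<comment> \<open>\<open>x\<close> is alive at \<open>t\<close> if it contributes to homology there. Its lifetime runs from the level of \<open>\<sigma>\<close>
    to that of \<open>\<tau>\<close>, or it never ends, and the simplices are the same for all \<open>g\<close> in the class.\<close>
  define dies where "dies x \<sigma> \<tau> \<longleftrightarrow> \<sigma> \<in> K \<and> \<tau> \<in> K \<and> f \<sigma> < f \<tau> \<and>
    (\<forall>g t. ordering_equiv K g f \<longrightarrow> live g t x \<longleftrightarrow> g \<sigma> \<le> t \<and> t < g \<tau>)" for x \<sigma> \<tau>
  define survives where "survives x \<sigma> \<longleftrightarrow> \<sigma> \<in> K \<and>
    (\<forall>g t. ordering_equiv K g f \<longrightarrow> live g t x \<longleftrightarrow> g \<sigma> \<le> t)" for x \<sigma>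
  define E1 where "E1 = {x \<in> E. \<exists>\<sigma> \<tau>. dies x \<sigma> \<tau>}"
  define E2 where "E2 = {x \<in> E - E1. \<exists>\<sigma>. survives x \<sigma>}"
  have live_E: "x \<in> E1 \<union> E2" if x: "x \<in> E" "ordering_equiv K g f" "live g t x" for x g t
  proof -
    have "x \<noteq> 0" using x(1) E(1) fun_space.dependent_zero by blast
    then have x0: "x \<notin> cycles {} p" "x \<notin> boundaries {} p" by (auto simp: cycles_empty boundaries_empty)
    have mono: "\<forall>L L'. L \<subseteq> L' \<and> finite L' \<longrightarrow> cycles L p \<subseteq> (cycles L' p :: ('v set \<Rightarrow> 'k) set)"
      "\<forall>L L'. L \<subseteq> L' \<and> finite L' \<longrightarrow> boundaries L p \<subseteq> (boundaries L' p :: ('v set \<Rightarrow> 'k) set)"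
      by (simp_all add: cycles_mono boundaries_mono)
    from K mono(1) x0(1) show ?thesis
    proof (cases rule: entry_time[where f = f])
      case never
      then show ?thesis using x by (auto simp: live_def)
    next
      case (enters \<sigma>)
      note birth = enters
      from K mono(2) x0(2) show ?thesis
      proof (cases rule: entry_time[where f = f])
        case never
        then have "survives x \<sigma>" using birth by (auto simp: survives_def live_def)
        then show ?thesis using x(1) by (auto simp: E2_def)
      next
        case (enters \<tau>)
        have "g \<sigma> < g \<tau>" using x(2,3) birth(2) enters(2) unfolding live_def by fastforce
        then have "f \<sigma> < f \<tau>" using ordering_equiv_le[OF x(2) enters(1) birth(1)] by linarith
        then have "dies x \<sigma> \<tau>" using birth enters by (auto simp: dies_def live_def)
        then show ?thesis using x(1) by (auto simp: E1_def)
      qed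
    qed
  qed
  have fin: "finite (E1 \<union> E2)"
  proof -
    have "x \<in> cycles K p" if "x \<in> E1 \<union> E2" for x
    proof -
      have "live f (f \<sigma>) x" if "dies x \<sigma> \<tau> \<or> survives x \<sigma>" for \<sigma> \<tau>
        using that ordering_equiv_refl[of K f] by (auto simp: dies_def survives_def)
      then obtain t where "live f t x" using \<open>x \<in> E1 \<union> E2\<close> unfolding E1_def E2_def by blast
      then show ?thesis using cycles_mono[of "sublevel K f t" K p] K
        by (auto simp: live_def sublevel_def)
    qed
    then have "E1 \<union> E2 \<subseteq> fun_space.span (unit_fun ` K)"
      using cycles_subset_span_unit_fun[OF K, of p] by blast
    moreover have "fun_space.independent (E1 \<union> E2)"
      by (rule fun_space.independent_mono[OF E(1)]) (auto simp: E1_def E2_def)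
    ultimately show ?thesis
      using fun_space.independent_span_bound[of "unit_fun ` K" "E1 \<union> E2"] K by simp
  qed
  obtain e1 where e1: "bij_betw e1 {..<card E1} E1"
    using ex_bij_betw_nat_finite[of E1] fin by (auto simp: atLeast0LessThan)
  obtain e2 where e2: "bij_betw e2 {..<card E2} E2"
    using ex_bij_betw_nat_finite[of E2] fin by (auto simp: atLeast0LessThan)
  define m where "m = card E1"
  define k where "k = card E2"
  define e where "e i = (if i < m then e1 i else e2 (i - m))" for i
  obtain b d where bd: "\<And>i. i < m \<Longrightarrow> dies (e1 i) (b i) (d i)"
  proof -
    have "\<forall>i. \<exists>\<sigma> \<tau>. i < m \<longrightarrow> dies (e1 i) \<sigma> \<tau>" using bij_betw_apply[OF e1] by (simp add: E1_def m_def)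
    then show ?thesis using that by metis
  qed
  obtain v where v: "\<And>j. j < k \<Longrightarrow> survives (e2 j) (v j)"
  proof -
    have "\<forall>j. \<exists>\<sigma>. j < k \<longrightarrow> survives (e2 j) \<sigma>" using bij_betw_apply[OF e2] by (simp add: E2_def k_def)
    then show ?thesis using that by metis
  qed
  have e_im: "e ` {..<m + k} = E1 \<union> E2"
  proof -
    have "e ` {..<m} = E1" using e1 by (auto simp: bij_betw_def e_def m_def)
    moreover have "e ` (\<lambda>j. m + j) ` {..<k} = E2"
    proof -
      have "e ` (\<lambda>j. m + j) ` {..<k} = e2 ` {..<k}"
        unfolding image_image by (intro image_cong) (auto simp: e_def)
      then show ?thesis using e2 by (simp add: bij_betw_def k_def)
    qed
    ultimately show ?thesis unfolding lessThan_add_eq image_Un by simp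
  qed
  have e_inj: "inj_on e {..<m + k}"
  proof -
    have "card (E1 \<union> E2) = m + k"
      unfolding m_def k_def using fin by (intro card_Un_disjoint) (auto simp: E2_def)
    then have "card (e ` {..<m + k}) = card {..<m + k}" by (simp add: e_im)
    then show ?thesis by (intro eq_card_imp_inj_on) auto
  qed
  show ?thesis
  proof (rule that[of m b d k v])
    show "\<forall>i<m. b i \<in> K \<and> d i \<in> K" using bd by (simp add: dies_def)
    show "\<forall>j<k. v j \<in> K" using v by (simp add: survives_def)
    show "\<forall>g. ordering_equiv K g f \<longrightarrow> (\<forall>i<m. g (b i) < g (d i)) \<and>
      pmodule_isomorphic (persistent_homology K p g :: ('k, _) pmodule)
        (interval_sum (m + k) (\<lambda>i. if i < m then {g (b i)..<g (d i)} else {g (v (i - m))..}))"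
    proof (intro allI impI conjI)
      fix g assume gf: "ordering_equiv K g f"
      show "g (b i) < g (d i)" if "i < m" for i
        using bd[OF that] ordering_equiv_le[OF gf, of "d i" "b i"] by (auto simp: dies_def not_le[symmetric])
      have "pmodule_isomorphic (filtered_homology (sublevel K g) p :: ('k, _) pmodule)
        (interval_sum (m + k) (\<lambda>i. if i < m then {g (b i)..<g (d i)} else {g (v (i - m))..}))"
      proof (rule interval_decomposition_of_adapted_basis[OF _ finite_sublevel[OF K] E(1) E(2)[OF gf] E(3)[OF gf] e_inj])
        show "mono (sublevel K g)" by (simp add: mono_def sublevel_mono)
        show "e ` {..<m + k} \<subseteq> E" unfolding e_im by (auto simp: E1_def E2_def)
        show "x \<in> e ` {..<m + k}"
          if "x \<in> E" "x \<in> cycles (sublevel K g t) p" "x \<notin> boundaries (sublevel K g t) p" for x t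
          unfolding e_im using live_E[OF that(1) gf, of t] that(2,3) by (simp add: live_def)
        show "t \<in> (if i < m then {g (b i)..<g (d i)} else {g (v (i - m))..}) \<longleftrightarrow>
          e i \<in> cycles (sublevel K g t) p \<and> e i \<notin> boundaries (sublevel K g t) p"
          if "i < m + k" for i t
          using bd[of i] v[of "i - m"] that gf unfolding live_def[symmetric]
          by (auto simp: e_def dies_def survives_def)
      qed
      then show "pmodule_isomorphic (persistent_homology K p g :: ('k, _) pmodule)
        (interval_sum (m + k) (\<lambda>i. if i < m then {g (b i)..<g (d i)} else {g (v (i - m))..}))"
        by (simp add: persistent_homology_def filtered_homology_def)
    qed
  qed
qed

text \<open>
  Any other decomposition has the same ranks, hence the same barcode; so the definite description
  is resolved by the given one.
\<close>

lemma Dgm_eq_barcode_of: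
  fixes K :: "'v::linorder set set"
  assumes K: "finite K"
    and iso: "pmodule_isomorphic (persistent_homology K p f :: ('k::field, _) pmodule) (interval_sum N J)"
    and J: "\<forall>i<N. is_interval (J i) \<and> J i \<noteq> {} \<and> bdd_below (J i)"
  shows "Dgm TYPE('k) K p f
    = barcode_of (image_mset (\<lambda>i. (Inf (J i), SUP t\<in>J i. ereal t)) (mset_set {..<N}))"
  unfolding Dgm_def
proof (rule the_equality)
  let ?P = "persistent_homology K p f :: ('k, _) pmodule"
  have closed: "pmodule_closed ?P"
    using pmodule_closed_filtered_homology[OF monoI[of "sublevel K f", OF sublevel_mono] finite_sublevel[OF K], of p]
    by (simp add: persistent_homology_def filtered_homology_def)
  let ?D = "barcode_of (image_mset (\<lambda>i. (Inf (J i), SUP t\<in>J i. ereal t)) (mset_set {..<N}))"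
  show "\<exists>N (J :: nat \<Rightarrow> real set). (\<forall>i<N. is_interval (J i) \<and> J i \<noteq> {}) \<and>
     pmodule_isomorphic ?P (interval_sum N J) \<and>
     ?D = barcode_of (image_mset (\<lambda>i. (Inf (J i), SUP t\<in>J i. ereal t)) (mset_set {..<N}))"
    using iso J by blast
  fix D assume "\<exists>N (J :: nat \<Rightarrow> real set). (\<forall>i<N. is_interval (J i) \<and> J i \<noteq> {}) \<and>
     pmodule_isomorphic ?P (interval_sum N J) \<and>
     D = barcode_of (image_mset (\<lambda>i. (Inf (J i), SUP t\<in>J i. ereal t)) (mset_set {..<N}))"
  then obtain N' J' where J': "\<forall>i<N'. is_interval (J' i) \<and> J' i \<noteq> {}"
    "pmodule_isomorphic ?P (interval_sum N' J')"
    "D = barcode_of (image_mset (\<lambda>i. (Inf (J' i), SUP t\<in>J' i. ereal t)) (mset_set {..<N'}))"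
    by blast
  have "rank_at N' J' s t = rank_at N J s t" if "s \<le> t" for s t
    using rank_at_le[OF closed iso J'(2) that] rank_at_le[OF closed J'(2) iso that] by simp
  then show "D = ?D"
    unfolding J'(3) using J'(1) J by (intro barcode_of_eq_if_rank_eq) auto
qed

lemma Dgm_eq_Q:
  fixes K :: "'v::linorder set set"
  assumes K: "finite K"
    and iso: "pmodule_isomorphic (persistent_homology K p g :: ('k::field, _) pmodule)
      (interval_sum (m + k) (\<lambda>i. if i < m then {b i..<d i} else {v (i - m)..}))"
    and bd: "\<And>i. i < m \<Longrightarrow> b i < d i"
  shows "Dgm TYPE('k) K p g = Q m k (\<lambda>i. if even i then b (i div 2) else d (i div 2), v)"
proof -
  define J where "J i = (if i < m then {b i..<d i} else {v (i - m)..})" for i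
  let ?pt = "\<lambda>i. (Inf (J i), SUP t\<in>J i. ereal t)"
  have J: "\<forall>i<m + k. is_interval (J i) \<and> J i \<noteq> {} \<and> bdd_below (J i)"
    using bd by (auto simp: J_def is_interval_1)
  have fin: "?pt i = (b i, ereal (d i))" if i: "i < m" for i
  proof -
    have Ji: "J i = {b i..<d i}" using i by (simp add: J_def)
    have "Inf (J i) = b i" using bd[OF i] by (simp add: Ji)
    moreover have "(SUP t\<in>J i. ereal t) = ereal (d i)"
    proof (rule interval_cases[of "J i"])
      show "is_interval (J i)" "J i \<noteq> {}" "bdd_below (J i)" using J i by auto
    next
      assume "{Inf (J i)<..} \<subseteq> J i"
      then have "max (Inf (J i)) (d i) + 1 \<in> J i" by (intro subsetD[of "{Inf (J i)<..}" "J i"]) auto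
      then show ?thesis unfolding Ji by (simp add: max_def split: if_splits)
    next
      fix u assume u: "(SUP t\<in>J i. ereal t) = ereal u" "{Inf (J i)<..<u} \<subseteq> J i" "J i \<subseteq> {Inf (J i)..u}"
      have "u \<le> d i"
        using u(2) bd[OF i]
        by (cases "b i < u") (simp_all add: Ji greaterThanLessThan_subseteq_atLeastLessThan_iff)
      moreover have "d i \<le> u"
        using u(3) bd[OF i] by (simp add: Ji atLeastLessThan_subseteq_atLeastAtMost_iff)
      ultimately show ?thesis using u(1) by simp
    qed
    ultimately show ?thesis by simp
  qed
  have inf: "?pt (m + j) = (v j, \<infinity>)" if "j < k" for j
  proof -
    have Jj: "J (m + j) = {v j..}" by (simp add: J_def)
    have "(SUP t\<in>{v j..}. ereal t) = \<infinity>"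
    proof (rule SUP_PInfty)
      fix n :: nat
      show "\<exists>t\<in>{v j..}. ereal (real n) \<le> ereal t"
        by (rule bexI[of _ "max (v j) (real n)"]) auto
    qed
    then show ?thesis by (simp add: Jj)
  qed
  have "image_mset ?pt (mset_set {..<m + k})
    = image_mset ?pt (mset_set {..<m}) + image_mset (\<lambda>j. ?pt (m + j)) (mset_set {..<k})"
  proof -
    have "mset_set {..<m + k} = mset_set ({..<m} \<union> (\<lambda>j. m + j) ` {..<k})"
      by (simp only: lessThan_add_eq)
    also have "\<dots> = mset_set {..<m} + mset_set ((\<lambda>j. m + j) ` {..<k})"
      by (rule mset_set_Union) auto
    also have "mset_set ((\<lambda>j. m + j) ` {..<k}) = image_mset (\<lambda>j. m + j) (mset_set {..<k})"
      by (rule image_mset_mset_set[symmetric]) simp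
    finally show ?thesis by (simp add: image_mset.compositionality o_def)
  qed
  also have "image_mset ?pt (mset_set {..<m}) = image_mset (\<lambda>i. (b i, ereal (d i))) (mset_set {..<m})"
    by (rule image_mset_cong) (use fin in auto)
  also have "image_mset (\<lambda>j. ?pt (m + j)) (mset_set {..<k}) = image_mset (\<lambda>j. (v j, \<infinity>)) (mset_set {..<k})"
    by (rule image_mset_cong) (use inf in auto)
  finally show ?thesis
    using Dgm_eq_barcode_of[OF K iso J[unfolded J_def]] by (simp add: Q_def J_def)
qed


section \<open>Filter functions of locally constant order\<close>

lemma openin_locally_order_constant: "openin M (locally_order_constant M K F)"
proof (subst openin_subopen, intro ballI)
  fix \<theta> assume "\<theta> \<in> locally_order_constant M K F"
  then obtain U where U: "openin M U" "\<theta> \<in> U" "\<And>\<theta>'. \<theta>' \<in> U \<Longrightarrow> ordering_equiv K (F \<theta>') (F \<theta>)"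
    by (auto simp: locally_order_constant_def)
  have "U \<subseteq> locally_order_constant M K F"
  proof
    fix \<eta> assume \<eta>: "\<eta> \<in> U"
    have "ordering_equiv K (F \<theta>') (F \<eta>)" if "\<theta>' \<in> U" for \<theta>'
      using U(3)[OF that] U(3)[OF \<eta>] by (simp add: ordering_equiv_def)
    then show "\<eta> \<in> locally_order_constant M K F"
      using U(1) \<eta> openin_subset[OF U(1)] by (auto simp: locally_order_constant_def)
  qed
  then show "\<exists>T. openin M T \<and> \<theta> \<in> T \<and> T \<subseteq> locally_order_constant M K F" using U by blast
qed

text \<open>
  In an open set, take a point \<open>\<theta>\<close> with the largest number of strict inequalities. Nearby these persist,
  by continuity, and no further ones can appear, by maximality.
\<close>

lemma dense_locally_order_constant:
  assumes K: "finite K" and F: "continuous_map M (powertop_real K) F"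
  shows "M closure_of (locally_order_constant M K F) = topspace M"
proof (subst dense_intersects_open, intro allI impI)
  fix T assume T: "openin M T \<and> T \<noteq> {}"
  define strict where "strict \<theta> = {(\<sigma>, \<tau>) \<in> K \<times> K. F \<theta> \<sigma> < F \<theta> \<tau>}" for \<theta>
  have fin: "finite (strict \<theta>)" for \<theta>
    using K by (auto simp: strict_def intro: finite_subset[of _ "K \<times> K"])
  obtain \<theta>\<^sub>0 where "\<theta>\<^sub>0 \<in> T" using T by blast
  moreover have "card (strict \<theta>) \<le> card (K \<times> K)" for \<theta>
    using K by (intro card_mono) (auto simp: strict_def)
  ultimately have "\<exists>\<theta>. \<theta> \<in> T \<and> (\<forall>\<theta>'. \<theta>' \<in> T \<longrightarrow> card (strict \<theta>') \<le> card (strict \<theta>))"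
    by (intro ex_has_greatest_nat[of _ \<theta>\<^sub>0 _ "Suc (card (K \<times> K))"]) (auto simp: less_Suc_eq_le)
  then obtain \<theta> where \<theta>: "\<theta> \<in> T" "\<And>\<theta>'. \<theta>' \<in> T \<Longrightarrow> card (strict \<theta>') \<le> card (strict \<theta>)" by blast
  define W where "W = (\<lambda>(\<sigma>, \<tau>). {\<theta>' \<in> topspace M. F \<theta>' \<sigma> < F \<theta>' \<tau>})"
  define U where "U = T \<inter> ((\<Inter>st\<in>strict \<theta>. W st) \<inter> topspace M)"
  have "openin M (W st)" if "st \<in> strict \<theta>" for st
  proof -
    obtain \<sigma> \<tau> where st: "st = (\<sigma>, \<tau>)" "\<sigma> \<in> K" "\<tau> \<in> K" using \<open>st \<in> strict \<theta>\<close> by (auto simp: strict_def)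
    have comp: "continuous_map M euclideanreal (\<lambda>\<theta>. F \<theta> \<rho>)" if "\<rho> \<in> K" for \<rho>
      using F that by (simp add: continuous_map_componentwise)
    have "continuous_map M euclideanreal (\<lambda>\<theta>. F \<theta> \<tau> - F \<theta> \<sigma>)"
      by (intro continuous_map_diff comp st)
    from openin_continuous_map_preimage[OF this, of "{0<..}"] show ?thesis
      by (simp add: W_def st(1))
  qed
  then have "openin M U"
    using T fin unfolding U_def by (intro openin_Int openin_INT) auto
  moreover have "\<theta> \<in> U"
    using \<theta>(1) T openin_subset[of M T] by (auto simp: U_def W_def strict_def)
  moreover have "ordering_equiv K (F \<theta>') (F \<theta>)" if "\<theta>' \<in> U" for \<theta>'
  proof -
    have "strict \<theta> \<subseteq> strict \<theta>'" using that by (auto simp: U_def W_def strict_def)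
    then have "strict \<theta> = strict \<theta>'"
      using \<theta>(2)[of \<theta>'] that fin by (intro card_seteq) (auto simp: U_def)
    then have "F \<theta>' \<sigma> < F \<theta>' \<tau> \<longleftrightarrow> F \<theta> \<sigma> < F \<theta> \<tau>" if "\<sigma> \<in> K" "\<tau> \<in> K" for \<sigma> \<tau>
      using that by (auto simp: strict_def)
    then show ?thesis unfolding ordering_equiv_def not_less[symmetric] by simp
  qed
  ultimately have "\<theta> \<in> locally_order_constant M K F"
    using openin_subset[of M U] by (auto simp: locally_order_constant_def)
  then show "locally_order_constant M K F \<inter> T \<noteq> {}" using \<theta>(1) by blast
qed

lemma generic_Int:
  assumes "generic M S" "generic M T"
  shows "generic M (S \<inter> T)"
  using assms unfolding generic_def dense_intersects_open
  by (metis (no_types, lifting) openin_Int inf_assoc)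

section \<open>Differentiability of the barcode\<close>

lemma Ck_euclid_subset: "Ck_euclid n k W f \<Longrightarrow> W' \<subseteq> W \<Longrightarrow> Ck_euclid n k W' f"
  by (induction k arbitrary: f) (auto intro: continuous_map_from_subtopology_mono)

lemma Cr_euclid_subset: "Cr_euclid n r W f \<Longrightarrow> W' \<subseteq> W \<Longrightarrow> Cr_euclid n r W' f"
  unfolding Cr_euclid_def using Ck_euclid_subset by blast

text \<open>
  A map whose components are components of \<open>F\<close>, possibly repeated, is as smooth as \<open>F\<close>.
\<close>

lemma Cr_on_coordinates:
  assumes F: "Cr_on n A r U K F" and U: "U' \<subseteq> U"
    and G: "\<And>i. i \<in> I \<Longrightarrow> s i \<in> K \<and> (\<forall>\<theta>. G \<theta> i = F \<theta> (s i))"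
  shows "Cr_on n A r U' I G"
  unfolding Cr_on_def
proof (intro ballI, clarify)
  fix V x i assume Vx: "(V, x) \<in> A" and i: "i \<in> I"
  have si: "s i \<in> K" "\<And>\<theta>. G \<theta> i = F \<theta> (s i)" using G[OF i] by auto
  have "Cr_euclid n r (x ` (U \<inter> V)) (\<lambda>u. F (inv_into V x u) (s i))"
    using bspec[OF F[unfolded Cr_on_def] Vx] si(1) by simp
  moreover have "x ` (U' \<inter> V) \<subseteq> x ` (U \<inter> V)" using U by blast
  ultimately show "Cr_euclid n r (x ` (U' \<inter> V)) (\<lambda>u. G (inv_into V x u) i)"
    unfolding si(2) by (rule Cr_euclid_subset)
qed

lemma r_differentiable_at_locally_order_constant:
  fixes K :: "'v::linorder set set"
  assumes K: "finite K" and U: "openin M U" "Cr_on n A r U K F"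
    and \<theta>: "\<theta> \<in> U" "\<theta> \<in> locally_order_constant M K F"
  shows "r_differentiable_at n M A r (Dgm TYPE('k::field) K p \<circ> F) \<theta>"
proof -
  obtain U' where U': "openin M U'" "\<theta> \<in> U'" "\<And>\<eta>. \<eta> \<in> U' \<Longrightarrow> ordering_equiv K (F \<eta>) (F \<theta>)"
    using \<theta>(2) by (auto simp: locally_order_constant_def)
  obtain m b d k v where dec: "\<forall>i<m. b i \<in> K \<and> d i \<in> K" "\<forall>j<k. v j \<in> K"
    "\<forall>g. ordering_equiv K g (F \<theta>) \<longrightarrow> (\<forall>i<m. g (b i) < g (d i)) \<and>
      pmodule_isomorphic (persistent_homology K p g :: ('k, _) pmodule)
        (interval_sum (m + k) (\<lambda>i. if i < m then {g (b i)..<g (d i)} else {g (v (i - m))..}))"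
    by (rule interval_decomposition_over_ordering_class[OF K, where f = "F \<theta>" and p = p])
  define s where "s i = (if even i then b (i div 2) else d (i div 2))" for i
  define Bt where "Bt \<eta> = (\<lambda>i. F \<eta> (s i), \<lambda>j. F \<eta> (v j))" for \<eta>
  have "Dgm TYPE('k) K p (F \<eta>) = Q m k (Bt \<eta>)" if "\<eta> \<in> U \<inter> U'" for \<eta>
  proof -
    have eq: "ordering_equiv K (F \<eta>) (F \<theta>)" using U'(3) that by blast
    have "Bt \<eta> = (\<lambda>i. if even i then F \<eta> (b (i div 2)) else F \<eta> (d (i div 2)), \<lambda>j. F \<eta> (v j))"
      by (auto simp: Bt_def s_def)
    moreover have "\<forall>i<m. F \<eta> (b i) < F \<eta> (d i)"
      and iso: "pmodule_isomorphic (persistent_homology K p (F \<eta>) :: ('k, _) pmodule) (interval_sum (m + k)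
        (\<lambda>i. if i < m then {F \<eta> (b i)..<F \<eta> (d i)} else {F \<eta> (v (i - m))..}))"
      using dec(3) eq by simp_all
    ultimately show ?thesis using Dgm_eq_Q[OF K iso] by simp
  qed
  moreover have "Cr_on n A r (U \<inter> U') {..<2 * m} (\<lambda>\<eta>. fst (Bt \<eta>))"
    by (rule Cr_on_coordinates[OF U(2), where s = s]) (auto simp: Bt_def s_def dec(1))
  moreover have "Cr_on n A r (U \<inter> U') {..<k} (\<lambda>\<eta>. snd (Bt \<eta>))"
    by (rule Cr_on_coordinates[OF U(2), where s = v]) (auto simp: Bt_def dec(2))
  ultimately show ?thesis
    unfolding r_differentiable_at_def using U(1) U'(1,2) \<theta>(1)
    by (intro exI[of _ "U \<inter> U'"] exI[of _ m] exI[of _ k] exI[of _ Bt]) auto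
qed

theorem theorem4p9:
  fixes K :: "'v::linorder set set" and p n :: nat and r :: enat
    and M :: "'m topology" and A :: "'m chart set"
    and F :: "'m \<Rightarrow> 'v set \<Rightarrow> real"
  assumes "finite K" and "abstract_simplicial_complex K"
    and "smooth_manifold n M A"
    and "\<forall>\<theta>\<in>topspace M. filter_function K (F \<theta>)"
    and "continuous_map M (powertop_real K) F"
  shows "(\<forall>U. openin M U \<and> Cr_on n A r U K F \<longrightarrow>
            (\<forall>\<theta> \<in> U \<inter> locally_order_constant M K F.
               r_differentiable_at n M A r (Dgm TYPE('k::field) K p \<circ> F) \<theta>)) \<and>
         generic M (locally_order_constant M K F) \<and>
         (\<forall>G. generic M G \<and> Cr_on n A r G K F \<longrightarrow>
            (\<exists>G'. generic M G' \<and> G' \<subseteq> G \<and>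
               (\<forall>\<theta>\<in>G'. r_differentiable_at n M A r (Dgm TYPE('k) K p \<circ> F) \<theta>)))"
proof (intro conjI allI impI ballI)
  have loc: "generic M (locally_order_constant M K F)"
    unfolding generic_def
    using openin_locally_order_constant dense_locally_order_constant[OF assms(1,5)] by blast
  then show "generic M (locally_order_constant M K F)" .
  show diff: "r_differentiable_at n M A r (Dgm TYPE('k) K p \<circ> F) \<theta>"
    if "openin M U \<and> Cr_on n A r U K F" "\<theta> \<in> U \<inter> locally_order_constant M K F" for U \<theta>
    using that by (intro r_differentiable_at_locally_order_constant[OF assms(1), of M U]) simp_all
  show "\<exists>G'. generic M G' \<and> G' \<subseteq> G \<and>
      (\<forall>\<theta>\<in>G'. r_differentiable_at n M A r (Dgm TYPE('k) K p \<circ> F) \<theta>)"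
    if G: "generic M G \<and> Cr_on n A r G K F" for G
  proof (intro exI[of _ "G \<inter> locally_order_constant M K F"] conjI ballI)
    show "generic M (G \<inter> locally_order_constant M K F)" using generic_Int G loc by blast
    show "r_differentiable_at n M A r (Dgm TYPE('k) K p \<circ> F) \<theta>"
      if "\<theta> \<in> G \<inter> locally_order_constant M K F" for \<theta>
      using diff[of G \<theta>] G that by (simp add: generic_def)
  qed blast
qed

end
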